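(* If a Finsler manifold $(M,F)$ admits an $\mathbf I$-projective vector field $X$, then $\pounds_{\hat X}\mathbf E=0$, $\pounds_{\hat X}\mathbf H=0$ and $\pounds_{\hat X}\mathbf B=0$.
   Context: $M$ is an $n$-dimensional smooth manifold, $TM_0=TM\setminus\{0\}$ with induced coordinates $(x^i,y^i)$. A Finsler structure is a continuous $F:TM\to[0,\infty)$, smooth on $TM_0$, positively 1-homogeneous on fibers, with $g_{ij}=\left(\tfrac12F^2\right)_{y^iy^j}$ positive definite on $TM_0$; $(g^{ij})$ is the inverse matrix. Spray coefficients: $G^i=\frac14 g^{il}\{[F^2]_{x^ky^l}y^k-[F^2]_{x^l}\}$; $G^i_j=\frac{\partial G^i}{\partial y^j}$, $\frac{\delta}{\delta x^i}=\frac{\partial}{\partial x^i}-G^j_i\frac{\partial}{\partial y^j}$, $\Gamma^i_{jk}=\frac12g^{il}\left(\frac{\delta g_{lk}}{\delta x^j}+\frac{\delta g_{jl}}{\delta x^k}-\frac{\delta g_{jk}}{\delta x^l}\right)$. $\nabla_k$ is the horizontal Cartan covariant derivative, i.e. $\frac{\delta}{\delta x^k}$ corrected in the usual way with $\Gamma^i_{jk}$ for each tensor index, and $\nabla_0=y^k\nabla_k$. Mean Cartan torsion $\mathbf I$: $I_i=\frac12g^{jk}\frac{\partial g_{jk}}{\partial y^i}$. Berwald curvature $\mathbf B$: $B^i_{jkl}=\frac{\partial^3G^i}{\partial y^j\partial y^k\partial y^l}$. $\mathbf E$-curvature: $E_{ij}=\frac12B^r_{irj}$ (equivalently half the vertical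 Hessian in $y$ of the S-curvature). $\mathbf H$-curvature: $\mathbf H_{ij}=\nabla_0E_{ij}$. For a vector field $X=X^i(x)\frac{\partial}{\partial x^i}$ on $M$, its complete lift is $\hat X=X^i\frac{\partial}{\partial x^i}+y^k\frac{\partial X^i}{\partial x^k}\frac{\partial}{\partial y^i}$ on $TM_0$, and $\pounds_{\hat X}$ denotes the Lie derivative along $\hat X$ of objects depending on $(x,y)$; e.g. $\pounds_{\hat X}G^i=\hat X(G^i)-G^j\frac{\partial X^i}{\partial x^j}+\frac12y^jy^k\frac{\partial^2X^i}{\partial x^j\partial x^k}$, and for tensors the usual formula, e.g. $\pounds_{\hat X}T^i_k=\hat X(T^i_k)-T^j_k\frac{\partial X^i}{\partial x^j}+T^i_j\frac{\partial X^j}{\partial x^k}$. $X$ is projective if its local flow maps geodesics to geodesics (as oriented point sets), equivalently if $\pounds_{\hat X}G^i=\Psi y^i$ for a function $\Psi(x,y)$ on $TM_0$, positively 1-homogeneous in $y$. A projective vector field $X$ is $\mathbf I$-projective if $\pounds_{\hat X}\mathbf I=0$. *)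

theory Defs
  imports "HOL-Analysis.Analysis"
begin

section \<open>Smooth maps on open subsets of Euclidean spaces\<close>

text \<open>\<open>Ck_on k f S\<close> is meant for open \<open>S\<close> only: derivatives are taken in the full space.\<close>

fun Ck_on :: "nat \<Rightarrow> ('a::euclidean_space \<Rightarrow> 'b::real_normed_vector) \<Rightarrow> 'a set \<Rightarrow> bool" where
  "Ck_on 0 f S \<longleftrightarrow> continuous_on S f"
| "Ck_on (Suc k) f S \<longleftrightarrow>
     (\<forall>x\<in>S. f differentiable (at x)) \<and>
     (\<forall>v. Ck_on k (\<lambda>x. frechet_derivative f (at x) v) S)"

definition smooth_on :: "('a::euclidean_space \<Rightarrow> 'b::real_normed_vector) \<Rightarrow> 'a set \<Rightarrow> bool" where
  "smooth_on f S \<longleftrightarrow> (\<forall>k. Ck_on k f S)"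


section \<open>Smooth manifolds and their tangent bundles\<close>

type_synonym ('m, 'n) chart = "'m set \<times> ('m \<Rightarrow> real^'n)"

definition chart_image :: "('m, 'n::finite) chart \<Rightarrow> (real^'n) set" where
  "chart_image c = snd c ` fst c"

definition chart_inv :: "('m, 'n::finite) chart \<Rightarrow> real^'n \<Rightarrow> 'm" where
  "chart_inv c = inv_into (fst c) (snd c)"

definition transition :: "('m, 'n::finite) chart \<Rightarrow> ('m, 'n) chart \<Rightarrow> real^'n \<Rightarrow> real^'n" where
  "transition c d = snd d \<circ> chart_inv c"

definition second_countable_space :: "'m topology \<Rightarrow> bool" where
  "second_countable_space M \<longleftrightarrow>
     (\<exists>\<B>. countable \<B> \<and> (\<forall>V\<in>\<B>. openin M V) \<and>
        (\<forall>U x. openin M U \<and> x \<in> U \<longrightarrow> (\<exists>V\<in>\<B>. x \<in> V \<and> V \<subseteq> U)))"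

text \<open>The atlas is not required to be maximal; all notions below are formulated in every
  chart of the given atlas.\<close>

definition smooth_manifold :: "'m topology \<Rightarrow> ('m, 'n::finite) chart set \<Rightarrow> bool" where
  "smooth_manifold M \<A> \<longleftrightarrow>
     Hausdorff_space M \<and> second_countable_space M \<and>
     (\<forall>c\<in>\<A>. openin M (fst c) \<and> open (chart_image c) \<and>
        homeomorphic_map (subtopology M (fst c)) (top_of_set (chart_image c)) (snd c)) \<and>
     (\<Union>c\<in>\<A>. fst c) = topspace M \<and>
     (\<forall>c\<in>\<A>. \<forall>d\<in>\<A>. smooth_on (transition c d) (snd c ` (fst c \<inter> fst d)))"

text \<open>A tangent vector at \<open>p\<close> is the family of its component vectors in all charts around
  \<open>p\<close>, related by the Jacobians of the transition maps. Setting the family to zero at all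
  other charts makes this representation unique.\<close>

type_synonym ('m, 'n) tvec = "('m, 'n) chart \<Rightarrow> real^'n"

definition tangent_space ::
    "('m, 'n::finite) chart set \<Rightarrow> 'm \<Rightarrow> ('m, 'n) tvec set" where
  "tangent_space \<A> p = {v.
     (\<forall>c\<in>\<A>. \<forall>d\<in>\<A>. p \<in> fst c \<and> p \<in> fst d \<longrightarrow>
        v d = frechet_derivative (transition c d) (at (snd c p)) (v c)) \<and>
     (\<forall>c. c \<notin> \<A> \<or> p \<notin> fst c \<longrightarrow> v c = 0)}"

definition tangent_bundle ::
    "'m topology \<Rightarrow> ('m, 'n::finite) chart set \<Rightarrow> ('m \<times> ('m, 'n) tvec) set" where
  "tangent_bundle M \<A> = (SIGMA p : topspace M. tangent_space \<A> p)"

definition slit_tangent_bundle ::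
    "'m topology \<Rightarrow> ('m, 'n::finite) chart set \<Rightarrow> ('m \<times> ('m, 'n) tvec) set" where
  "slit_tangent_bundle M \<A> = {(p, v) \<in> tangent_bundle M \<A>. v \<noteq> (\<lambda>c. 0)}"

text \<open>The point of the tangent bundle with induced coordinates \<open>(x, y)\<close> in the chart \<open>c\<close>.\<close>

definition tangent_of_coords ::
    "('m, 'n::finite) chart set \<Rightarrow> ('m, 'n) chart \<Rightarrow> real^'n \<Rightarrow> real^'n \<Rightarrow> 'm \<times> ('m, 'n) tvec" where
  "tangent_of_coords \<A> c x y =
     (chart_inv c x,
      \<lambda>d. if d \<in> \<A> \<and> chart_inv c x \<in> fst d
          then frechet_derivative (transition c d) (at x) y else 0)"

definition pos_homogeneous1_on ::
    "('m \<times> ('m, 'n::finite) tvec) set \<Rightarrow> ('m \<times> ('m, 'n) tvec \<Rightarrow> real) \<Rightarrow> bool" where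
  "pos_homogeneous1_on S f \<longleftrightarrow>
     (\<forall>(p, v)\<in>S. \<forall>a>0. f (p, \<lambda>c. a *\<^sub>R v c) = a * f (p, v))"

definition smooth_vector_field ::
    "'m topology \<Rightarrow> ('m, 'n::finite) chart set \<Rightarrow> ('m \<Rightarrow> ('m, 'n) tvec) \<Rightarrow> bool" where
  "smooth_vector_field M \<A> X \<longleftrightarrow>
     (\<forall>p\<in>topspace M. X p \<in> tangent_space \<A> p) \<and>
     (\<forall>c\<in>\<A>. smooth_on (\<lambda>x. X (chart_inv c x) c) (chart_image c))"


section \<open>Local Finsler geometry in induced coordinates\<close>

text \<open>Functions of \<open>(x, y)\<close>; a tensor is the family of its components, upper indices first.\<close>

type_synonym 'n cfun = "real^'n \<Rightarrow> real^'n \<Rightarrow> real"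

definition pdx :: "'n::finite \<Rightarrow> 'n cfun \<Rightarrow> 'n cfun" where
  "pdx k f = (\<lambda>x y. deriv (\<lambda>t. f (x + t *\<^sub>R axis k 1) y) 0)"

definition pdy :: "'n::finite \<Rightarrow> 'n cfun \<Rightarrow> 'n cfun" where
  "pdy k f = (\<lambda>x y. deriv (\<lambda>t. f x (y + t *\<^sub>R axis k 1)) 0)"

definition gmat :: "'n::finite cfun \<Rightarrow> real^'n \<Rightarrow> real^'n \<Rightarrow> real^'n^'n" where
  "gmat L x y = (\<chi> i j. pdy j (pdy i (\<lambda>x y. (L x y)\<^sup>2 / 2)) x y)"

definition g_low :: "'n::finite cfun \<Rightarrow> 'n \<Rightarrow> 'n \<Rightarrow> 'n cfun" where
  "g_low L i j = (\<lambda>x y. gmat L x y $ i $ j)"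

definition g_up :: "'n::finite cfun \<Rightarrow> 'n \<Rightarrow> 'n \<Rightarrow> 'n cfun" where
  "g_up L i j = (\<lambda>x y. matrix_inv (gmat L x y) $ i $ j)"

definition spray :: "'n::finite cfun \<Rightarrow> 'n \<Rightarrow> 'n cfun" where
  "spray L i = (\<lambda>x y. 1/4 * (\<Sum>l\<in>UNIV. g_up L i l x y *
     ((\<Sum>k\<in>UNIV. pdy l (pdx k (\<lambda>x y. (L x y)\<^sup>2)) x y * y $ k)
       - pdx l (\<lambda>x y. (L x y)\<^sup>2) x y)))"

definition nonlin_conn :: "'n::finite cfun \<Rightarrow> 'n \<Rightarrow> 'n \<Rightarrow> 'n cfun" where
  "nonlin_conn L i j = pdy j (spray L i)"

definition delta_x :: "'n::finite cfun \<Rightarrow> 'n \<Rightarrow> 'n cfun \<Rightarrow> 'n cfun" where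
  "delta_x L i f = (\<lambda>x y. pdx i f x y - (\<Sum>j\<in>UNIV. nonlin_conn L j i x y * pdy j f x y))"

definition Gamma_coeff :: "'n::finite cfun \<Rightarrow> 'n \<Rightarrow> 'n \<Rightarrow> 'n \<Rightarrow> 'n cfun" where
  "Gamma_coeff L i j k = (\<lambda>x y. 1/2 * (\<Sum>l\<in>UNIV. g_up L i l x y *
     (delta_x L j (g_low L l k) x y + delta_x L k (g_low L j l) x y
       - delta_x L l (g_low L j k) x y)))"

text \<open>Horizontal Cartan derivative \<open>\<nabla>\<^sub>k T\<^sub>i\<^sub>j\<close> of a covariant 2-tensor, and \<open>\<nabla>\<^sub>0 = y\<^sup>k \<nabla>\<^sub>k\<close>.\<close>

definition nabla_cov2 ::
    "'n::finite cfun \<Rightarrow> 'n \<Rightarrow> ('n \<Rightarrow> 'n \<Rightarrow> 'n cfun) \<Rightarrow> 'n \<Rightarrow> 'n \<Rightarrow> 'n cfun" where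
  "nabla_cov2 L k T i j = (\<lambda>x y. delta_x L k (T i j) x y
     - (\<Sum>r\<in>UNIV. Gamma_coeff L r i k x y * T r j x y)
     - (\<Sum>r\<in>UNIV. Gamma_coeff L r j k x y * T i r x y))"

definition nabla0_cov2 ::
    "'n::finite cfun \<Rightarrow> ('n \<Rightarrow> 'n \<Rightarrow> 'n cfun) \<Rightarrow> 'n \<Rightarrow> 'n \<Rightarrow> 'n cfun" where
  "nabla0_cov2 L T i j = (\<lambda>x y. \<Sum>k\<in>UNIV. y $ k * nabla_cov2 L k T i j x y)"

definition mean_cartan :: "'n::finite cfun \<Rightarrow> 'n \<Rightarrow> 'n cfun" where
  "mean_cartan L i = (\<lambda>x y. 1/2 * (\<Sum>j\<in>UNIV. \<Sum>k\<in>UNIV.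
     g_up L j k x y * pdy i (g_low L j k) x y))"

definition berwald_curv :: "'n::finite cfun \<Rightarrow> 'n \<Rightarrow> 'n \<Rightarrow> 'n \<Rightarrow> 'n \<Rightarrow> 'n cfun" where
  "berwald_curv L i j k l = pdy l (pdy k (pdy j (spray L i)))"

definition E_curv :: "'n::finite cfun \<Rightarrow> 'n \<Rightarrow> 'n \<Rightarrow> 'n cfun" where
  "E_curv L i j = (\<lambda>x y. 1/2 * (\<Sum>r\<in>UNIV. berwald_curv L r i r j x y))"

definition H_curv :: "'n::finite cfun \<Rightarrow> 'n \<Rightarrow> 'n \<Rightarrow> 'n cfun" where
  "H_curv L = nabla0_cov2 L (E_curv L)"


section \<open>Complete lifts and Lie derivatives in induced coordinates\<close>

text \<open>\<open>Z\<close> is the coordinate expression of a vector field on the base;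
  \<open>dX Z i j = \<partial>Z\<^sup>i/\<partial>x\<^sup>j\<close>, as a function of \<open>(x, y)\<close> not depending on \<open>y\<close>.\<close>

definition dX :: "(real^'n \<Rightarrow> real^'n) \<Rightarrow> 'n::finite \<Rightarrow> 'n \<Rightarrow> 'n cfun" where
  "dX Z i j = pdx j (\<lambda>x y. Z x $ i)"

definition complete_lift :: "(real^'n \<Rightarrow> real^'n) \<Rightarrow> 'n::finite cfun \<Rightarrow> 'n cfun" where
  "complete_lift Z f = (\<lambda>x y. (\<Sum>i\<in>UNIV. Z x $ i * pdx i f x y)
     + (\<Sum>i\<in>UNIV. (\<Sum>k\<in>UNIV. y $ k * dX Z i k x y) * pdy i f x y))"

definition lie_spray ::
    "(real^'n \<Rightarrow> real^'n) \<Rightarrow> ('n \<Rightarrow> 'n cfun) \<Rightarrow> 'n::finite \<Rightarrow> 'n cfun" where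
  "lie_spray Z G i = (\<lambda>x y. complete_lift Z (G i) x y
     - (\<Sum>j\<in>UNIV. G j x y * dX Z i j x y)
     + 1/2 * (\<Sum>j\<in>UNIV. \<Sum>k\<in>UNIV. y $ j * y $ k * pdx j (dX Z i k) x y))"

definition lie_cov1 ::
    "(real^'n \<Rightarrow> real^'n) \<Rightarrow> ('n \<Rightarrow> 'n cfun) \<Rightarrow> 'n::finite \<Rightarrow> 'n cfun" where
  "lie_cov1 Z T i = (\<lambda>x y. complete_lift Z (T i) x y
     + (\<Sum>r\<in>UNIV. T r x y * dX Z r i x y))"

definition lie_cov2 ::
    "(real^'n \<Rightarrow> real^'n) \<Rightarrow> ('n \<Rightarrow> 'n \<Rightarrow> 'n cfun) \<Rightarrow> 'n::finite \<Rightarrow> 'n \<Rightarrow> 'n cfun" where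
  "lie_cov2 Z T i j = (\<lambda>x y. complete_lift Z (T i j) x y
     + (\<Sum>r\<in>UNIV. T r j x y * dX Z r i x y)
     + (\<Sum>r\<in>UNIV. T i r x y * dX Z r j x y))"

definition lie_con1_cov3 ::
    "(real^'n \<Rightarrow> real^'n) \<Rightarrow> ('n \<Rightarrow> 'n \<Rightarrow> 'n \<Rightarrow> 'n \<Rightarrow> 'n cfun) \<Rightarrow>
       'n::finite \<Rightarrow> 'n \<Rightarrow> 'n \<Rightarrow> 'n \<Rightarrow> 'n cfun" where
  "lie_con1_cov3 Z T i j k l = (\<lambda>x y. complete_lift Z (T i j k l) x y
     - (\<Sum>r\<in>UNIV. T r j k l x y * dX Z i r x y)
     + (\<Sum>r\<in>UNIV. T i r k l x y * dX Z r j x y)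
     + (\<Sum>r\<in>UNIV. T i j r l x y * dX Z r k x y)
     + (\<Sum>r\<in>UNIV. T i j k r x y * dX Z r l x y))"


section \<open>Finsler manifolds and projective vector fields\<close>

definition local_expr ::
    "('m, 'n::finite) chart set \<Rightarrow> ('m, 'n) chart \<Rightarrow> ('m \<times> ('m, 'n) tvec \<Rightarrow> real) \<Rightarrow> 'n cfun" where
  "local_expr \<A> c f = (\<lambda>x y. f (tangent_of_coords \<A> c x y))"

definition local_vf ::
    "('m, 'n::finite) chart \<Rightarrow> ('m \<Rightarrow> ('m, 'n) tvec) \<Rightarrow> real^'n \<Rightarrow> real^'n" where
  "local_vf c X = (\<lambda>x. X (chart_inv c x) c)"

definition finsler_manifold ::
    "'m topology \<Rightarrow> ('m, 'n::finite) chart set \<Rightarrow> ('m \<times> ('m, 'n) tvec \<Rightarrow> real) \<Rightarrow> bool" where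
  "finsler_manifold M \<A> F \<longleftrightarrow>
     smooth_manifold M \<A> \<and>
     (\<forall>u\<in>tangent_bundle M \<A>. F u \<ge> 0) \<and>
     pos_homogeneous1_on (tangent_bundle M \<A>) F \<and>
     (\<forall>c\<in>\<A>.
        continuous_on (chart_image c \<times> UNIV) (\<lambda>(x, y). local_expr \<A> c F x y) \<and>
        smooth_on (\<lambda>(x, y). local_expr \<A> c F x y) (chart_image c \<times> (UNIV - {0})) \<and>
        (\<forall>x\<in>chart_image c. \<forall>y. y \<noteq> 0 \<longrightarrow>
           (\<forall>v. v \<noteq> 0 \<longrightarrow> v \<bullet> (gmat (local_expr \<A> c F) x y *v v) > 0)))"

text \<open>The condition on the Lie derivative of the spray coefficients is the infinitesimal form of
  the requirement that the local flow of \<open>X\<close> maps geodesics to geodesics as oriented point sets.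
  No smoothness of \<open>\<Psi>\<close> is assumed; it follows from the equation.\<close>

definition projective_vf ::
    "'m topology \<Rightarrow> ('m, 'n::finite) chart set \<Rightarrow> ('m \<times> ('m, 'n) tvec \<Rightarrow> real) \<Rightarrow>
       ('m \<Rightarrow> ('m, 'n) tvec) \<Rightarrow> bool" where
  "projective_vf M \<A> F X \<longleftrightarrow>
     smooth_vector_field M \<A> X \<and>
     (\<exists>\<Psi>. pos_homogeneous1_on (slit_tangent_bundle M \<A>) \<Psi> \<and>
        (\<forall>c\<in>\<A>. \<forall>x\<in>chart_image c. \<forall>y. y \<noteq> 0 \<longrightarrow>
           (\<forall>i. lie_spray (local_vf c X) (spray (local_expr \<A> c F)) i x y
                  = local_expr \<A> c \<Psi> x y * y $ i)))"

definition lie_I_zero ::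
    "('m, 'n::finite) chart set \<Rightarrow> ('m \<times> ('m, 'n) tvec \<Rightarrow> real) \<Rightarrow>
       ('m \<Rightarrow> ('m, 'n) tvec) \<Rightarrow> bool" where
  "lie_I_zero \<A> F X \<longleftrightarrow> (\<forall>c\<in>\<A>. \<forall>x\<in>chart_image c. \<forall>y. y \<noteq> 0 \<longrightarrow>
     (\<forall>i. lie_cov1 (local_vf c X) (mean_cartan (local_expr \<A> c F)) i x y = 0))"

definition lie_E_zero ::
    "('m, 'n::finite) chart set \<Rightarrow> ('m \<times> ('m, 'n) tvec \<Rightarrow> real) \<Rightarrow>
       ('m \<Rightarrow> ('m, 'n) tvec) \<Rightarrow> bool" where
  "lie_E_zero \<A> F X \<longleftrightarrow> (\<forall>c\<in>\<A>. \<forall>x\<in>chart_image c. \<forall>y. y \<noteq> 0 \<longrightarrow>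
     (\<forall>i j. lie_cov2 (local_vf c X) (E_curv (local_expr \<A> c F)) i j x y = 0))"

definition lie_H_zero ::
    "('m, 'n::finite) chart set \<Rightarrow> ('m \<times> ('m, 'n) tvec \<Rightarrow> real) \<Rightarrow>
       ('m \<Rightarrow> ('m, 'n) tvec) \<Rightarrow> bool" where
  "lie_H_zero \<A> F X \<longleftrightarrow> (\<forall>c\<in>\<A>. \<forall>x\<in>chart_image c. \<forall>y. y \<noteq> 0 \<longrightarrow>
     (\<forall>i j. lie_cov2 (local_vf c X) (H_curv (local_expr \<A> c F)) i j x y = 0))"

definition lie_B_zero ::
    "('m, 'n::finite) chart set \<Rightarrow> ('m \<times> ('m, 'n) tvec \<Rightarrow> real) \<Rightarrow>
       ('m \<Rightarrow> ('m, 'n) tvec) \<Rightarrow> bool" where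
  "lie_B_zero \<A> F X \<longleftrightarrow> (\<forall>c\<in>\<A>. \<forall>x\<in>chart_image c. \<forall>y. y \<noteq> 0 \<longrightarrow>
     (\<forall>i j k l. lie_con1_cov3 (local_vf c X) (berwald_curv (local_expr \<A> c F)) i j k l x y = 0))"

definition I_projective_vf ::
    "'m topology \<Rightarrow> ('m, 'n::finite) chart set \<Rightarrow> ('m \<times> ('m, 'n) tvec \<Rightarrow> real) \<Rightarrow>
       ('m \<Rightarrow> ('m, 'n) tvec) \<Rightarrow> bool" where
  "I_projective_vf M \<A> F X \<longleftrightarrow> projective_vf M \<A> F X \<and> lie_I_zero \<A> F X"

end

theory Submission
  imports Defs
begin

text \<open>
  Write \<open>X^\<close> for the complete lift, \<open>C = y\<^sup>k \<partial>/\<partial>y\<^sup>k\<close> for the Euler field, \<open>S = y\<^sup>k \<partial>/\<partial>x\<^sup>k - 2 G\<^sup>k \<partial>/\<partial>y\<^sup>k\<close> for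
  the spray as a vector field, \<open>N\<^sup>i\<^sub>j\<close> for the fibre derivative \<open>\<partial>G\<^sup>i/\<partial>y\<^sup>j\<close>, and \<open>n\<close> for the dimension.

  Fibre derivatives commute with Lie derivatives along \<open>X^\<close>, so \<open>\<pounds>B\<close> is the third fibre derivative of
  \<open>\<pounds>G\<^sup>i = \<Psi> y\<^sup>i\<close>. It vanishes as soon as the second fibre derivatives of \<open>\<Psi>\<close> do, and this is what the
  condition on the mean Cartan torsion provides. Put \<open>f = ln (sqrt (det g))\<close>. The torsion is the fibre
  derivative of \<open>f\<close>, so \<open>\<pounds>I = 0\<close> says that the fibre derivatives of \<open>X^ f\<close> vanish. On the other hand
  differentiating the defining equation of the spray gives \<open>N\<^sup>i\<^sub>i = S f\<close>. The bracket of \<open>X^\<close> and \<open>S\<close> is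
  \<open>-2 (\<pounds>G\<^sup>i) \<partial>/\<partial>y\<^sup>i = -2 \<Psi> C\<close>, and \<open>C f = 0\<close> by homogeneity, so \<open>X^ (N\<^sup>i\<^sub>i) = S (X^ f) = y\<^sup>k \<partial>(X^ f)/\<partial>x\<^sup>k\<close>.
  Comparing with the trace of the fibre derivative of \<open>\<pounds>G\<^sup>i = \<Psi> y\<^sup>i\<close> yields
  \<open>(n + 1) \<Psi> = y\<^sup>k \<partial>(X^ f + div X)/\<partial>x\<^sup>k\<close> (lemma \<open>psi_eq\<close>), an expression linear in \<open>y\<close> near each point,
  whence \<open>pdy_pdy_psi\<close> and \<open>lie_B\<close>. Only derivatives of \<open>X^ f\<close> occur; its constancy on fibres is never
  asserted, and for \<open>n = 1\<close> the punctured fibres are not connected.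

  \<open>\<pounds>E = 0\<close> is the trace of \<open>\<pounds>B = 0\<close>. For \<open>H\<close>, the identity \<open>y\<^sup>k \<Gamma>\<^sup>r\<^sub>i\<^sub>k = N\<^sup>r\<^sub>i\<close> (lemma \<open>Gamma_contract\<close>) turns
  \<open>\<nabla>\<^sub>0 E\<close> into \<open>S E\<^sub>i\<^sub>j - N\<^sup>r\<^sub>i E\<^sub>r\<^sub>j - N\<^sup>r\<^sub>j E\<^sub>i\<^sub>r\<close>, and the Lie derivatives of \<open>S\<close> and \<open>N\<close> cancel each other because
  \<open>E\<close> is homogeneous of degree \<open>-1\<close> and annihilates \<open>y\<close> (lemma \<open>lie_H\<close>).

  The function \<open>f\<close> itself does not appear. A derivation \<open>D\<close> has \<open>D f = (1/2) g\<^sup>j\<^sup>k D g\<^sub>j\<^sub>k\<close>, and the rule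
  \<open>D (D' f) - D' (D f) = [D, D'] f\<close> is proved directly for these traces (\<open>half_trace_commutator\<close>).
  The whole argument takes place in one chart, where smoothness and homogeneity of the coordinate
  expression of \<open>F\<close>, positivity of \<open>g\<close>, homogeneity of \<open>\<Psi>\<close> and smoothness of the components of the
  vector field are what is left of the manifold.
\<close>

section \<open>Smooth functions\<close>

text \<open>The closure properties go by induction on the order, for all functions at once: the derivative of
  a sum, product, inverse or composite is given by a formula that holds on \<open>S\<close> only, and this lemma
  passes from that formula to the derivative itself.\<close>

lemma Ck_on_cong:
  assumes "open S" "\<And>p. p \<in> S \<Longrightarrow> f p = g p" "Ck_on k f S"
  shows "Ck_on k g S"
  using assms(2,3)
proof (induction k arbitrary: f g)
  case 0
  then show ?case by (simp cong: continuous_on_cong)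
next
  case (Suc k)
  have d: "g differentiable (at p)" and e: "frechet_derivative g (at p) = frechet_derivative f (at p)"
    if "p \<in> S" for p
  proof -
    from Suc.prems(2) that have fd: "(f has_derivative frechet_derivative f (at p)) (at p)"
      by (simp add: frechet_derivative_works)
    from has_derivative_transform_within_open[OF fd \<open>open S\<close> that] Suc.prems(1)
    have gd: "(g has_derivative frechet_derivative f (at p)) (at p)" by simp
    then show "g differentiable (at p)" by (rule differentiableI)
    from gd show "frechet_derivative g (at p) = frechet_derivative f (at p)"
      using frechet_derivative_at by metis
  qed
  show ?case
    using Suc.IH[of "\<lambda>x. frechet_derivative f (at x) v" "\<lambda>x. frechet_derivative g (at x) v" for v]
      Suc.prems(2) d e by auto
qed

lemma Ck_on_Suc_imp: "Ck_on (Suc k) f S \<Longrightarrow> Ck_on k f S"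
proof (induction k arbitrary: f)
  case 0
  then show ?case
    by (auto intro!: continuous_at_imp_continuous_on differentiable_imp_continuous_within)
next
  case (Suc k)
  have "\<forall>x\<in>S. f differentiable at x"
    and "Ck_on (Suc k) (\<lambda>x. frechet_derivative f (at x) v) S" for v
    using Suc.prems unfolding Ck_on.simps(2)[of "Suc k" f S] by blast+
  with Suc.IH show ?case unfolding Ck_on.simps(2)[of k f S] by blast
qed

lemma Ck_on_const: "Ck_on k (\<lambda>p. c) S"
  by (induction k arbitrary: c) auto

lemma Ck_on_bounded_linear:
  assumes "bounded_linear f"
  shows "Ck_on k f S"
proof (cases k)
  case 0
  then show ?thesis by (simp add: assms linear_continuous_on)
next
  case (Suc k')
  have "frechet_derivative f (at p) = f" for p
    using frechet_derivative_at[OF bounded_linear_imp_has_derivative[OF assms]] by metis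
  then show ?thesis
    by (simp add: Suc Ck_on_const bounded_linear_imp_differentiable assms)
qed

lemma Ck_on_add:
  assumes "open S" "Ck_on k f S" "Ck_on k g S"
  shows "Ck_on k (\<lambda>p. f p + g p) S"
  using assms(2,3)
proof (induction k arbitrary: f g)
  case 0
  then show ?case by (simp add: continuous_on_add)
next
  case (Suc k)
  have e: "frechet_derivative f (at p) v + frechet_derivative g (at p) v
      = frechet_derivative (\<lambda>p. f p + g p) (at p) v" if "p \<in> S" for p v
    using Suc.prems that
    by (intro fun_cong[OF frechet_derivative_at] has_derivative_add)
      (auto simp: frechet_derivative_works[symmetric])
  have "Ck_on k (\<lambda>p. frechet_derivative (\<lambda>p. f p + g p) (at p) v) S" for v
    by (rule Ck_on_cong[OF \<open>open S\<close> e Suc.IH]) (use Suc.prems in auto)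
  then show ?case using Suc.prems by auto
qed

lemma Ck_on_mult:
  fixes f g :: "'a::euclidean_space \<Rightarrow> real"
  assumes "open S" "Ck_on k f S" "Ck_on k g S"
  shows "Ck_on k (\<lambda>p. f p * g p) S"
  using assms(2,3)
proof (induction k arbitrary: f g)
  case 0
  then show ?case by (simp add: continuous_on_mult)
next
  case (Suc k)
  have e: "f p * frechet_derivative g (at p) v + frechet_derivative f (at p) v * g p
      = frechet_derivative (\<lambda>p. f p * g p) (at p) v" if "p \<in> S" for p v
    using Suc.prems that
    by (intro fun_cong[OF frechet_derivative_at] has_derivative_mult)
      (auto simp: frechet_derivative_works[symmetric])
  have "Ck_on k f S" "Ck_on k g S"
    using Suc.prems Ck_on_Suc_imp by blast+
  then have "Ck_on k (\<lambda>p. frechet_derivative (\<lambda>p. f p * g p) (at p) v) S" for v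
    by (intro Ck_on_cong[OF \<open>open S\<close> e] Ck_on_add[OF \<open>open S\<close>] Suc.IH) (use Suc.prems in auto)
  then show ?case using Suc.prems by auto
qed

lemma Ck_on_inverse:
  fixes f :: "'a::euclidean_space \<Rightarrow> real"
  assumes "open S" "Ck_on k f S" "\<And>p. p \<in> S \<Longrightarrow> f p \<noteq> 0"
  shows "Ck_on k (\<lambda>p. inverse (f p)) S"
  using assms(2)
proof (induction k)
  case 0
  then show ?case using assms(3) by (simp add: continuous_on_inverse)
next
  case (Suc k)
  have d: "((\<lambda>p. inverse (f p)) has_derivative
        (\<lambda>v. - (inverse (f p) * frechet_derivative f (at p) v * inverse (f p)))) (at p)"
    if "p \<in> S" for p
    using Suc.prems that assms(3)[OF that]
    by (intro Deriv.has_derivative_inverse) (auto simp: frechet_derivative_works[symmetric])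
  have e: "- 1 * ((inverse (f p) * frechet_derivative f (at p) v) * inverse (f p))
      = frechet_derivative (\<lambda>p. inverse (f p)) (at p) v" if "p \<in> S" for p v
    using fun_cong[OF frechet_derivative_at[OF d[OF that]], of v] by simp
  have i: "Ck_on k (\<lambda>p. inverse (f p)) S"
    using Suc Ck_on_Suc_imp by blast
  have "Ck_on k (\<lambda>p. frechet_derivative (\<lambda>p. inverse (f p)) (at p) v) S" for v
    by (intro Ck_on_cong[OF \<open>open S\<close> e] Ck_on_mult[OF \<open>open S\<close>] Ck_on_const i)
      (use Suc.prems in auto)
  then show ?case unfolding Ck_on.simps using d differentiableI by blast
qed

lemma Ck_on_linear_comp:
  assumes "open S" "bounded_linear h" "Ck_on k f S"
  shows "Ck_on k (\<lambda>p. h (f p)) S"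
  using assms(3)
proof (induction k arbitrary: f)
  case 0
  then show ?case using assms(2) by (simp add: bounded_linear.continuous_on)
next
  case (Suc k)
  have d: "((\<lambda>p. h (f p)) has_derivative (\<lambda>v. h (frechet_derivative f (at p) v))) (at p)"
    if "p \<in> S" for p
    using Suc.prems that
    by (intro bounded_linear.has_derivative[OF assms(2)]) (auto simp: frechet_derivative_works[symmetric])
  have e: "h (frechet_derivative f (at p) v) = frechet_derivative (\<lambda>p. h (f p)) (at p) v"
    if "p \<in> S" for p v
    using fun_cong[OF frechet_derivative_at[OF d[OF that]], of v] by simp
  have "Ck_on k (\<lambda>p. frechet_derivative (\<lambda>p. h (f p)) (at p) v) S" for v
    by (rule Ck_on_cong[OF \<open>open S\<close> e], assumption, rule Suc.IH) (use Suc.prems in auto)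
  then show ?case unfolding Ck_on.simps using d differentiableI by blast
qed

lemma Ck_on_comp_linear:
  assumes "open S" "bounded_linear h" "\<And>p. p \<in> S \<Longrightarrow> h p \<in> T" "Ck_on k f T"
  shows "Ck_on k (\<lambda>p. f (h p)) S"
  using assms(4)
proof (induction k arbitrary: f)
  case 0
  have "continuous_on S h" by (simp add: assms(2) linear_continuous_on)
  with 0 show ?case using assms(3) by (auto intro: continuous_on_compose2)
next
  case (Suc k)
  have d: "((\<lambda>p. f (h p)) has_derivative (\<lambda>v. frechet_derivative f (at (h p)) (h v))) (at p)"
    if "p \<in> S" for p
    using Suc.prems that assms(3)
    by (intro has_derivative_compose[OF bounded_linear_imp_has_derivative[OF assms(2)]])
      (auto simp: frechet_derivative_works[symmetric])
  have e: "frechet_derivative f (at (h p)) (h v) = frechet_derivative (\<lambda>p. f (h p)) (at p) v"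
    if "p \<in> S" for p v
    using fun_cong[OF frechet_derivative_at[OF d[OF that]], of v] by simp
  have "Ck_on k (\<lambda>p. frechet_derivative (\<lambda>p. f (h p)) (at p) v) S" for v
    by (rule Ck_on_cong[OF \<open>open S\<close> e], assumption, rule Suc.IH) (use Suc.prems in auto)
  then show ?case unfolding Ck_on.simps using d differentiableI by blast
qed

lemma smooth_on_frechet_derivative:
  "smooth_on f S \<Longrightarrow> smooth_on (\<lambda>p. frechet_derivative f (at p) v) S"
  unfolding smooth_on_def by (metis Ck_on.simps(2))

lemma smooth_on_differentiable: "smooth_on f S \<Longrightarrow> p \<in> S \<Longrightarrow> f differentiable (at p)"
  unfolding smooth_on_def by (metis Ck_on.simps(2))

lemma smooth_on_continuous: "smooth_on f S \<Longrightarrow> continuous_on S f"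
  unfolding smooth_on_def by (metis Ck_on.simps(1))

section \<open>Symmetry of second derivatives\<close>

text \<open>The mean value theorem in the direction \<open>u\<close>, applied to the increment in the direction \<open>v\<close>,
  followed by the mean value theorem in the direction \<open>v\<close>. The left-hand side is symmetric in \<open>u\<close>
  and \<open>v\<close>, and this symmetry is inherited by the second derivative.\<close>

lemma second_difference_mean_value:
  fixes f :: "'a::euclidean_space \<Rightarrow> real"
  assumes t: "0 < t"
    and S: "\<And>a b. 0 \<le> a \<Longrightarrow> a \<le> t \<Longrightarrow> 0 \<le> b \<Longrightarrow> b \<le> t \<Longrightarrow> p + a *\<^sub>R u + b *\<^sub>R v \<in> S"
    and f: "smooth_on f S"
  obtains \<xi> \<eta> where "0 < \<xi>" "\<xi> < t" "0 < \<eta>" "\<eta> < t"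
    "f (p + t *\<^sub>R u + t *\<^sub>R v) - f (p + t *\<^sub>R u) - f (p + t *\<^sub>R v) + f p
      = t * t * frechet_derivative (\<lambda>q. frechet_derivative f (at q) u) (at (p + \<xi> *\<^sub>R u + \<eta> *\<^sub>R v)) v"
proof -
  define fu where "fu q = frechet_derivative f (at q) u" for q
  have fu: "smooth_on fu S" unfolding fu_def by (rule smooth_on_frechet_derivative[OF f])
  have du: "((\<lambda>a. f (p + a *\<^sub>R u + b *\<^sub>R v)) has_real_derivative fu (p + a *\<^sub>R u + b *\<^sub>R v)) (at a)"
    if "0 \<le> a" "a \<le> t" "0 \<le> b" "b \<le> t" for a b
  proof -
    have "(f has_derivative frechet_derivative f (at (p + a *\<^sub>R u + b *\<^sub>R v))) (at (p + a *\<^sub>R u + b *\<^sub>R v))"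
      using smooth_on_differentiable[OF f S[OF that]] by (simp add: frechet_derivative_works)
    moreover have "((\<lambda>a. p + a *\<^sub>R u + b *\<^sub>R v) has_derivative (\<lambda>h. h *\<^sub>R u)) (at a)"
      by (auto intro!: derivative_eq_intros)
    ultimately have D: "((\<lambda>a. f (p + a *\<^sub>R u + b *\<^sub>R v)) has_derivative
        (\<lambda>h. frechet_derivative f (at (p + a *\<^sub>R u + b *\<^sub>R v)) (h *\<^sub>R u))) (at a)"
      by (rule has_derivative_compose[rotated])
    have "linear (frechet_derivative f (at (p + a *\<^sub>R u + b *\<^sub>R v)))"
      using smooth_on_differentiable[OF f S[OF that]] by (rule linear_frechet_derivative)
    then have "(\<lambda>h. frechet_derivative f (at (p + a *\<^sub>R u + b *\<^sub>R v)) (h *\<^sub>R u))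
        = (*) (fu (p + a *\<^sub>R u + b *\<^sub>R v))"
      by (auto simp: fu_def linear_scale mult.commute)
    with D show ?thesis by (simp add: has_field_derivative_def)
  qed
  have dv: "((\<lambda>b. fu (p + a *\<^sub>R u + b *\<^sub>R v)) has_real_derivative
      frechet_derivative fu (at (p + a *\<^sub>R u + b *\<^sub>R v)) v) (at b)"
    if "0 \<le> a" "a \<le> t" "0 \<le> b" "b \<le> t" for a b
  proof -
    have "(fu has_derivative frechet_derivative fu (at (p + a *\<^sub>R u + b *\<^sub>R v))) (at (p + a *\<^sub>R u + b *\<^sub>R v))"
      using smooth_on_differentiable[OF fu S[OF that]] by (simp add: frechet_derivative_works)
    moreover have "((\<lambda>b. p + a *\<^sub>R u + b *\<^sub>R v) has_derivative (\<lambda>h. h *\<^sub>R v)) (at b)"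
      by (auto intro!: derivative_eq_intros)
    ultimately have D: "((\<lambda>b. fu (p + a *\<^sub>R u + b *\<^sub>R v)) has_derivative
        (\<lambda>h. frechet_derivative fu (at (p + a *\<^sub>R u + b *\<^sub>R v)) (h *\<^sub>R v))) (at b)"
      by (rule has_derivative_compose[rotated])
    have "linear (frechet_derivative fu (at (p + a *\<^sub>R u + b *\<^sub>R v)))"
      using smooth_on_differentiable[OF fu S[OF that]] by (rule linear_frechet_derivative)
    then have "(\<lambda>h. frechet_derivative fu (at (p + a *\<^sub>R u + b *\<^sub>R v)) (h *\<^sub>R v))
        = (*) (frechet_derivative fu (at (p + a *\<^sub>R u + b *\<^sub>R v)) v)"
      by (auto simp: linear_scale mult.commute)
    with D show ?thesis by (simp add: has_field_derivative_def)
  qed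
  define d where "d a = f (p + a *\<^sub>R u + t *\<^sub>R v) - f (p + a *\<^sub>R u + 0 *\<^sub>R v)" for a
  have "\<exists>\<xi>>0. \<xi> < t \<and> d t - d 0 = (t - 0) * (fu (p + \<xi> *\<^sub>R u + t *\<^sub>R v) - fu (p + \<xi> *\<^sub>R u + 0 *\<^sub>R v))"
    unfolding d_def using t by (intro MVT2 DERIV_diff du) auto
  then obtain \<xi> where \<xi>: "0 < \<xi>" "\<xi> < t"
    "d t - d 0 = t * (fu (p + \<xi> *\<^sub>R u + t *\<^sub>R v) - fu (p + \<xi> *\<^sub>R u + 0 *\<^sub>R v))"
    by auto
  have "\<exists>\<eta>>0. \<eta> < t \<and> fu (p + \<xi> *\<^sub>R u + t *\<^sub>R v) - fu (p + \<xi> *\<^sub>R u + 0 *\<^sub>R v)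
      = (t - 0) * frechet_derivative fu (at (p + \<xi> *\<^sub>R u + \<eta> *\<^sub>R v)) v"
    using t \<xi> by (intro MVT2 dv) auto
  then obtain \<eta> where \<eta>: "0 < \<eta>" "\<eta> < t"
    "fu (p + \<xi> *\<^sub>R u + t *\<^sub>R v) - fu (p + \<xi> *\<^sub>R u + 0 *\<^sub>R v)
      = t * frechet_derivative fu (at (p + \<xi> *\<^sub>R u + \<eta> *\<^sub>R v)) v"
    by auto
  have "f (p + t *\<^sub>R u + t *\<^sub>R v) - f (p + t *\<^sub>R u) - f (p + t *\<^sub>R v) + f p = d t - d 0"
    by (simp add: d_def)
  also have "\<dots> = t * t * frechet_derivative fu (at (p + \<xi> *\<^sub>R u + \<eta> *\<^sub>R v)) v"
    unfolding \<xi>(3) \<eta>(3) by simp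
  finally show ?thesis
    using that \<xi>(1,2) \<eta>(1,2) by (simp add: fu_def[abs_def])
qed

text \<open>By continuity, both iterated derivatives are limits of the same second difference quotient.\<close>

lemma frechet_derivative_commute:
  fixes f :: "'a::euclidean_space \<Rightarrow> real"
  assumes "open S" "smooth_on f S" "p \<in> S"
  shows "frechet_derivative (\<lambda>q. frechet_derivative f (at q) u) (at p) v
       = frechet_derivative (\<lambda>q. frechet_derivative f (at q) v) (at p) u"
    (is "?A p = ?B p")
proof (rule ccontr)
  assume ne: "?A p \<noteq> ?B p"
  define e where "e = \<bar>?A p - ?B p\<bar> / 2"
  have e: "e > 0" using ne by (simp add: e_def)
  have cA: "continuous_on S ?A" and cB: "continuous_on S ?B"
    by (intro smooth_on_continuous smooth_on_frechet_derivative assms)+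
  from cA \<open>open S\<close> \<open>p \<in> S\<close> have "isCont ?A p" by (simp add: continuous_on_eq_continuous_at)
  then obtain d1 where d1: "d1 > 0" "\<And>q. dist q p < d1 \<Longrightarrow> dist (?A q) (?A p) < e"
    using e unfolding continuous_at_eps_delta by blast
  from cB \<open>open S\<close> \<open>p \<in> S\<close> have "isCont ?B p" by (simp add: continuous_on_eq_continuous_at)
  then obtain d2 where d2: "d2 > 0" "\<And>q. dist q p < d2 \<Longrightarrow> dist (?B q) (?B p) < e"
    using e unfolding continuous_at_eps_delta by blast
  obtain d3 where d3: "d3 > 0" "ball p d3 \<subseteq> S"
    using \<open>open S\<close> \<open>p \<in> S\<close> open_contains_ball by blast
  define d where "d = min d1 (min d2 d3)"
  \<comment> \<open>The factor 2 keeps the whole parallelogram with sides \<open>t u\<close> and \<open>t v\<close> inside the open ball of radius \<open>d\<close>.\<close>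
  define t where "t = d / (2 * (norm u + norm v + 1))"
  have d: "d > 0" using d1 d2 d3 by (simp add: d_def)
  have t: "t > 0" unfolding t_def using d by (intro divide_pos_pos) (auto intro: add_nonneg_pos)
  have near: "dist (p + a *\<^sub>R u + b *\<^sub>R v) p < d" if "0 \<le> a" "a \<le> t" "0 \<le> b" "b \<le> t" for a b
  proof -
    have "dist (p + a *\<^sub>R u + b *\<^sub>R v) p = norm (a *\<^sub>R u + b *\<^sub>R v)"
      by (simp add: dist_norm)
    also have "\<dots> \<le> a * norm u + b * norm v"
      using norm_triangle_ineq[of "a *\<^sub>R u" "b *\<^sub>R v"] that by simp
    also have "\<dots> \<le> t * norm u + t * norm v"
      using that by (intro add_mono mult_right_mono) auto
    also have "\<dots> \<le> t * (norm u + norm v + 1)"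
      using t by (simp add: algebra_simps)
    also have "\<dots> = d / 2"
    proof -
      have "norm u + norm v + 1 \<noteq> 0"
        using norm_ge_zero[of u] norm_ge_zero[of v] by linarith
      then show ?thesis by (simp add: t_def field_simps)
    qed
    finally show ?thesis using d by simp
  qed
  have inS: "p + a *\<^sub>R u + b *\<^sub>R v \<in> S" if "0 \<le> a" "a \<le> t" "0 \<le> b" "b \<le> t" for a b
    using near[OF that] d3(2) by (auto simp: d_def dist_commute subset_iff)
  obtain \<xi> \<eta> where 1: "0 < \<xi>" "\<xi> < t" "0 < \<eta>" "\<eta> < t"
    "f (p + t *\<^sub>R u + t *\<^sub>R v) - f (p + t *\<^sub>R u) - f (p + t *\<^sub>R v) + f p = t * t * ?A (p + \<xi> *\<^sub>R u + \<eta> *\<^sub>R v)"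
    using second_difference_mean_value[OF t inS assms(2)] by blast
  have inS': "p + a *\<^sub>R v + b *\<^sub>R u \<in> S" if "0 \<le> a" "a \<le> t" "0 \<le> b" "b \<le> t" for a b
    using inS[of b a] that by (simp add: algebra_simps)
  obtain \<xi>' \<eta>' where 2: "0 < \<xi>'" "\<xi>' < t" "0 < \<eta>'" "\<eta>' < t"
    "f (p + t *\<^sub>R v + t *\<^sub>R u) - f (p + t *\<^sub>R v) - f (p + t *\<^sub>R u) + f p = t * t * ?B (p + \<xi>' *\<^sub>R v + \<eta>' *\<^sub>R u)"
    using second_difference_mean_value[OF t inS' assms(2)] by blast
  have sw: "p + a *\<^sub>R v + b *\<^sub>R u = p + b *\<^sub>R u + a *\<^sub>R v" for a b by simp
  have "t * t * ?A (p + \<xi> *\<^sub>R u + \<eta> *\<^sub>R v) = t * t * ?B (p + \<xi>' *\<^sub>R v + \<eta>' *\<^sub>R u)"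
    using 1(5) 2(5) sw[of t t] by (simp only: algebra_simps)
  then have eq: "?A (p + \<xi> *\<^sub>R u + \<eta> *\<^sub>R v) = ?B (p + \<eta>' *\<^sub>R u + \<xi>' *\<^sub>R v)"
    using t unfolding sw[of \<xi>' \<eta>'] by simp
  have "dist (?A (p + \<xi> *\<^sub>R u + \<eta> *\<^sub>R v)) (?A p) < e"
    using near[of \<xi> \<eta>] 1 by (intro d1(2)) (auto simp: d_def)
  moreover have "dist (?B (p + \<eta>' *\<^sub>R u + \<xi>' *\<^sub>R v)) (?B p) < e"
    using near[of \<eta>' \<xi>'] 2 by (intro d2(2)) (auto simp: d_def)
  ultimately show False
    using dist_triangle_less_add[of "?A p" "?B (p + \<eta>' *\<^sub>R u + \<xi>' *\<^sub>R v)" e "?B p" e]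
    unfolding eq by (simp add: e_def dist_commute) (simp add: dist_real_def)
qed

section \<open>Component functions on an open set of the tangent bundle\<close>

definition smooth_cfun :: "((real^'n) \<times> (real^'n)) set \<Rightarrow> 'n::finite cfun \<Rightarrow> bool" where
  "smooth_cfun W f \<longleftrightarrow> smooth_on (\<lambda>(x, y). f x y) W"

lemma smooth_cfun_cong:
  assumes "open W" "\<And>x y. (x, y) \<in> W \<Longrightarrow> f x y = g x y" "smooth_cfun W f"
  shows "smooth_cfun W g"
  unfolding smooth_cfun_def smooth_on_def
proof
  fix k
  show "Ck_on k (\<lambda>(x, y). g x y) W"
    by (rule Ck_on_cong[OF assms(1), of "\<lambda>(x, y). f x y"])
      (use assms in \<open>auto simp: smooth_cfun_def smooth_on_def\<close>)
qed

lemma smooth_cfun_const: "smooth_cfun W (\<lambda>x y. c)"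
  by (simp add: smooth_cfun_def smooth_on_def case_prod_unfold Ck_on_const)

lemma smooth_cfun_snd: "smooth_cfun W (\<lambda>x y. y $ k)"
  unfolding smooth_cfun_def smooth_on_def case_prod_unfold
  by (intro allI Ck_on_bounded_linear bounded_linear_compose[OF bounded_linear_vec_nth bounded_linear_snd])

lemma smooth_cfun_base:
  assumes "open U" "smooth_on Z U" "open W" "\<And>x y. (x, y) \<in> W \<Longrightarrow> x \<in> U"
  shows "smooth_cfun W (\<lambda>x y. Z x $ i)"
  unfolding smooth_cfun_def smooth_on_def case_prod_unfold
proof
  fix k
  have "Ck_on k (\<lambda>p. Z (fst p)) W"
    using assms(2,4) by (intro Ck_on_comp_linear[OF assms(3) bounded_linear_fst, of U]) (auto simp: smooth_on_def)
  then show "Ck_on k (\<lambda>p. Z (fst p) $ i) W"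
    by (rule Ck_on_linear_comp[OF assms(3) bounded_linear_vec_nth])
qed

lemma smooth_cfun_add:
  "open W \<Longrightarrow> smooth_cfun W f \<Longrightarrow> smooth_cfun W g \<Longrightarrow> smooth_cfun W (\<lambda>x y. f x y + g x y)"
  by (simp add: smooth_cfun_def smooth_on_def case_prod_unfold Ck_on_add)

lemma smooth_cfun_mult:
  "open W \<Longrightarrow> smooth_cfun W f \<Longrightarrow> smooth_cfun W g \<Longrightarrow> smooth_cfun W (\<lambda>x y. f x y * g x y)"
  by (simp add: smooth_cfun_def smooth_on_def case_prod_unfold Ck_on_mult)

lemma smooth_cfun_minus: "open W \<Longrightarrow> smooth_cfun W f \<Longrightarrow> smooth_cfun W (\<lambda>x y. - f x y)"
  using smooth_cfun_mult[OF _ smooth_cfun_const[of W "- 1"]] by simp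

lemma smooth_cfun_diff:
  "open W \<Longrightarrow> smooth_cfun W f \<Longrightarrow> smooth_cfun W g \<Longrightarrow> smooth_cfun W (\<lambda>x y. f x y - g x y)"
  using smooth_cfun_add[OF _ _ smooth_cfun_minus] by fastforce

lemma smooth_cfun_divide:
  assumes "open W" "smooth_cfun W f" "smooth_cfun W g" "\<And>x y. (x, y) \<in> W \<Longrightarrow> g x y \<noteq> 0"
  shows "smooth_cfun W (\<lambda>x y. f x y / g x y)"
proof -
  have "smooth_cfun W (\<lambda>x y. inverse (g x y))"
    using assms by (auto simp: smooth_cfun_def smooth_on_def case_prod_unfold intro!: Ck_on_inverse)
  from smooth_cfun_mult[OF assms(1,2) this] show ?thesis by (simp add: divide_inverse)
qed

lemma smooth_cfun_sum:
  assumes "open W" "\<And>i. i \<in> I \<Longrightarrow> smooth_cfun W (f i)"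
  shows "smooth_cfun W (\<lambda>x y. \<Sum>i\<in>I. f i x y)"
  using assms(2)
  by (induction I rule: infinite_finite_induct)
    (auto intro: smooth_cfun_const smooth_cfun_add[OF assms(1)])

lemma smooth_cfun_prod:
  assumes "open W" "\<And>i. i \<in> I \<Longrightarrow> smooth_cfun W (f i)"
  shows "smooth_cfun W (\<lambda>x y. \<Prod>i\<in>I. f i x y)"
  using assms(2)
  by (induction I rule: infinite_finite_induct)
    (auto intro: smooth_cfun_const smooth_cfun_mult[OF assms(1)])

lemma smooth_cfun_power:
  "open W \<Longrightarrow> smooth_cfun W f \<Longrightarrow> smooth_cfun W (\<lambda>x y. f x y ^ m)"
  by (induction m) (auto intro: smooth_cfun_const smooth_cfun_mult)

text \<open>The Leibniz formula makes a determinant a polynomial in the entries.\<close>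

lemma smooth_cfun_det:
  assumes "open W" "\<And>i j. smooth_cfun W (\<lambda>x y. A x y $ i $ j)"
  shows "smooth_cfun W (\<lambda>x y. det (A x y :: real^'n^'n::finite))"
  unfolding det_def using assms
  by (intro smooth_cfun_sum smooth_cfun_mult smooth_cfun_const smooth_cfun_prod)

text \<open>Cramer's rule makes the entries of the inverse rational functions of the entries of the matrix,
  with the nowhere vanishing determinant as denominator.\<close>

lemma smooth_cfun_matrix_inv:
  assumes "open W" "\<And>i j. smooth_cfun W (\<lambda>x y. A x y $ i $ j)"
    and inv: "\<And>x y. (x, y) \<in> W \<Longrightarrow> invertible (A x y :: real^'n^'n::finite)"
  shows "smooth_cfun W (\<lambda>x y. matrix_inv (A x y) $ i $ j)"
proof (rule smooth_cfun_cong[OF assms(1)])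
  fix x y assume W: "(x, y) \<in> W"
  from inv[OF W] have "A x y ** matrix_inv (A x y) = mat 1"
    unfolding invertible_def matrix_inv_def by (rule someI2_ex) simp
  then have "A x y *v (matrix_inv (A x y) *v axis j 1) = axis j 1"
    by (simp add: matrix_vector_mul_assoc)
  moreover have "det (A x y) \<noteq> 0" using inv[OF W] by (simp add: invertible_det_nz)
  ultimately have "matrix_inv (A x y) *v axis j 1 =
      (\<chi> k. det (\<chi> a b. if b = k then axis j 1 $ a else A x y $ a $ b) / det (A x y))"
    using cramer by blast
  then have "(matrix_inv (A x y) *v axis j 1) $ i
      = det (\<chi> a b. if b = i then axis j 1 $ a else A x y $ a $ b) / det (A x y)"
    by simp
  then show "det (\<chi> a b. if b = i then axis j 1 $ a else A x y $ a $ b) / det (A x y)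
      = matrix_inv (A x y) $ i $ j"
    by (simp add: matrix_vector_mul_component inner_axis)
next
  have "smooth_cfun W (\<lambda>x y. (\<chi> a b. if b = i then axis j 1 $ a else A x y $ a $ b) $ a $ b)" for a b
    by (cases "b = i") (simp_all add: smooth_cfun_const assms(2))
  then show "smooth_cfun W (\<lambda>x y. det (\<chi> a b. if b = i then axis j 1 $ a else A x y $ a $ b) / det (A x y))"
    using inv by (intro smooth_cfun_divide smooth_cfun_det assms(1,2)) (auto simp: invertible_det_nz)
qed

section \<open>Coordinate derivatives\<close>

text \<open>The link between the coordinate derivatives, defined along lines, and the total derivative, in
  terms of which smoothness is defined.\<close>

lemma has_real_derivative_along:
  assumes "smooth_cfun W f" "(x, y) \<in> W"
  shows "((\<lambda>t. f (x + t *\<^sub>R u) (y + t *\<^sub>R v)) has_real_derivative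
           frechet_derivative (\<lambda>(x, y). f x y) (at (x, y)) (u, v)) (at 0)"
proof -
  let ?f = "\<lambda>(x, y). f x y"
  have df: "?f differentiable (at (x, y))"
    using assms by (auto simp: smooth_cfun_def intro: smooth_on_differentiable)
  then have "(?f has_derivative frechet_derivative ?f (at (x, y))) (at (x + 0 *\<^sub>R u, y + 0 *\<^sub>R v))"
    by (simp add: frechet_derivative_works)
  moreover have "((\<lambda>t. (x + t *\<^sub>R u, y + t *\<^sub>R v)) has_derivative (\<lambda>h. h *\<^sub>R (u, v))) (at 0)"
    by (auto intro!: derivative_eq_intros)
  ultimately have "((\<lambda>t. ?f (x + t *\<^sub>R u, y + t *\<^sub>R v)) has_derivative
      (\<lambda>h. frechet_derivative ?f (at (x, y)) (h *\<^sub>R (u, v)))) (at 0)"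
    by (rule has_derivative_compose[rotated])
  moreover have "(\<lambda>h. frechet_derivative ?f (at (x, y)) (h *\<^sub>R (u, v)))
      = (*) (frechet_derivative ?f (at (x, y)) (u, v))"
    using linear_scale[OF linear_frechet_derivative[OF df], of _ "(u, v)"] by (auto simp: mult.commute)
  ultimately show ?thesis by (simp add: has_field_derivative_def)
qed

lemma pdx_frechet:
  assumes "smooth_cfun W f" "(x, y) \<in> W"
  shows "pdx k f x y = frechet_derivative (\<lambda>(x, y). f x y) (at (x, y)) (axis k 1, 0)"
  using DERIV_imp_deriv[OF has_real_derivative_along[OF assms, of "axis k 1" 0]] by (simp add: pdx_def)

lemma pdy_frechet:
  assumes "smooth_cfun W f" "(x, y) \<in> W"
  shows "pdy k f x y = frechet_derivative (\<lambda>(x, y). f x y) (at (x, y)) (0, axis k 1)"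
  using DERIV_imp_deriv[OF has_real_derivative_along[OF assms, of 0 "axis k 1"]] by (simp add: pdy_def)

text \<open>Base and fibre derivatives as one family indexed by a sum type, so that a vector field on the
  tangent bundle is a single linear combination.\<close>

definition pd :: "'n::finite + 'n \<Rightarrow> 'n cfun \<Rightarrow> 'n cfun" where
  "pd = case_sum pdx pdy"

definition pd_dir :: "'n::finite + 'n \<Rightarrow> (real^'n) \<times> (real^'n)" where
  "pd_dir = case_sum (\<lambda>k. (axis k 1, 0)) (\<lambda>k. (0, axis k 1))"

lemma pd_frechet:
  assumes "smooth_cfun W f" "(x, y) \<in> W"
  shows "pd \<alpha> f x y = frechet_derivative (\<lambda>(x, y). f x y) (at (x, y)) (pd_dir \<alpha>)"
  using assms by (cases \<alpha>) (auto simp: pd_def pd_dir_def pdx_frechet pdy_frechet)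

lemma pd_cong:
  assumes "open W" "\<And>x y. (x, y) \<in> W \<Longrightarrow> f x y = g x y" "(x, y) \<in> W"
  shows "pd \<alpha> f x y = pd \<alpha> g x y"
proof -
  have *: "\<forall>\<^sub>F t in nhds 0. f (x + t *\<^sub>R u) (y + t *\<^sub>R v) = g (x + t *\<^sub>R u) (y + t *\<^sub>R v)" for u v
  proof -
    have "((\<lambda>t. (x + t *\<^sub>R u, y + t *\<^sub>R v)) \<longlongrightarrow> (x + 0 *\<^sub>R u, y + 0 *\<^sub>R v)) (nhds 0)"
      by (intro tendsto_intros filterlim_ident)
    then have "\<forall>\<^sub>F t in nhds 0. (x + t *\<^sub>R u, y + t *\<^sub>R v) \<in> W"
      using assms(1,3) by (auto simp: tendsto_def)
    then show ?thesis by (rule eventually_mono) (rule assms(2))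
  qed
  show ?thesis
    using *[of _ 0] *[of 0]
    by (cases \<alpha>) (auto simp: pd_def pdx_def pdy_def intro!: deriv_cong_ev)
qed

lemma smooth_cfun_pd:
  assumes "open W" "smooth_cfun W f"
  shows "smooth_cfun W (pd \<alpha> f)"
proof (rule smooth_cfun_cong[OF assms(1)])
  show "smooth_cfun W (\<lambda>x y. frechet_derivative (\<lambda>(x, y). f x y) (at (x, y)) (pd_dir \<alpha>))"
    using smooth_on_frechet_derivative assms(2) by (auto simp: smooth_cfun_def case_prod_unfold)
qed (use pd_frechet[OF assms(2)] in simp)

lemma pd_commute:
  assumes "open W" "smooth_cfun W f" "(x, y) \<in> W"
  shows "pd \<alpha> (pd \<beta> f) x y = pd \<beta> (pd \<alpha> f) x y"
proof -
  have *: "pd \<alpha> (pd \<beta> f) x y = frechet_derivative (\<lambda>q. frechet_derivative (\<lambda>(x, y). f x y) (at q) (pd_dir \<beta>))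
      (at (x, y)) (pd_dir \<alpha>)" for \<alpha> \<beta>
  proof -
    let ?g = "\<lambda>x y. frechet_derivative (\<lambda>(x, y). f x y) (at (x, y)) (pd_dir \<beta>)"
    have "smooth_cfun W ?g"
      using smooth_on_frechet_derivative assms(2) by (auto simp: smooth_cfun_def case_prod_unfold)
    have "pd \<alpha> (pd \<beta> f) x y = pd \<alpha> ?g x y"
      by (rule pd_cong[OF assms(1) pd_frechet[OF assms(2)] assms(3)])
    also have "\<dots> = frechet_derivative (\<lambda>(x, y). ?g x y) (at (x, y)) (pd_dir \<alpha>)"
      by (rule pd_frechet) fact+
    finally show ?thesis by (simp add: case_prod_unfold)
  qed
  show ?thesis
    unfolding * using assms by (intro frechet_derivative_commute) (auto simp: smooth_cfun_def)
qed

section \<open>Derivations\<close>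

text \<open>Coordinate derivatives, the complete lift of a vector field, the spray and the Euler field enter
  the computations through the following properties only. The congruence rule is stated for arbitrary
  functions: it is what allows an identity on \<open>W\<close> to be differentiated.\<close>

locale derivation =
  fixes W :: "((real^'n) \<times> (real^'n)) set" and D :: "'n::finite cfun \<Rightarrow> 'n cfun"
  assumes open_domain: "open W"
    and smooth: "smooth_cfun W f \<Longrightarrow> smooth_cfun W (D f)"
    and cong: "(\<And>x y. (x, y) \<in> W \<Longrightarrow> f x y = g x y) \<Longrightarrow> (x, y) \<in> W \<Longrightarrow> D f x y = D g x y"
    and const: "(x, y) \<in> W \<Longrightarrow> D (\<lambda>x y. c) x y = 0"
    and add: "smooth_cfun W f \<Longrightarrow> smooth_cfun W g \<Longrightarrow> (x, y) \<in> W \<Longrightarrow>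
        D (\<lambda>x y. f x y + g x y) x y = D f x y + D g x y"
    and mult: "smooth_cfun W f \<Longrightarrow> smooth_cfun W g \<Longrightarrow> (x, y) \<in> W \<Longrightarrow>
        D (\<lambda>x y. f x y * g x y) x y = D f x y * g x y + f x y * D g x y"
begin

lemma cmult: "smooth_cfun W f \<Longrightarrow> (x, y) \<in> W \<Longrightarrow> D (\<lambda>x y. c * f x y) x y = c * D f x y"
  by (subst mult) (auto simp: const smooth_cfun_const)

lemma minus: "smooth_cfun W f \<Longrightarrow> (x, y) \<in> W \<Longrightarrow> D (\<lambda>x y. - f x y) x y = - D f x y"
  using cmult[of f x y "- 1"] by simp

lemma diff: "smooth_cfun W f \<Longrightarrow> smooth_cfun W g \<Longrightarrow> (x, y) \<in> W \<Longrightarrow>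
    D (\<lambda>x y. f x y - g x y) x y = D f x y - D g x y"
  using add[of f "\<lambda>x y. - g x y" x y] by (simp add: minus smooth_cfun_minus open_domain)

lemma sum:
  assumes "\<And>i. i \<in> I \<Longrightarrow> smooth_cfun W (f i)" "(x, y) \<in> W"
  shows "D (\<lambda>x y. \<Sum>i\<in>I. f i x y) x y = (\<Sum>i\<in>I. D (f i) x y)"
  using assms(1)
proof (induction I rule: infinite_finite_induct)
  case (insert i I)
  then show ?case
    using assms(2) by (simp add: add smooth_cfun_sum open_domain)
qed (simp_all add: const assms(2))

text \<open>The Leibniz rule in the form in which index contractions are differentiated.\<close>

lemma sum_mult:
  assumes "\<And>i. i \<in> I \<Longrightarrow> smooth_cfun W (f i)" "\<And>i. i \<in> I \<Longrightarrow> smooth_cfun W (g i)" "(x, y) \<in> W"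
  shows "D (\<lambda>x y. \<Sum>i\<in>I. f i x y * g i x y) x y
    = (\<Sum>i\<in>I. D (f i) x y * g i x y) + (\<Sum>i\<in>I. f i x y * D (g i) x y)"
proof -
  have "D (\<lambda>x y. \<Sum>i\<in>I. f i x y * g i x y) x y = (\<Sum>i\<in>I. D (\<lambda>x y. f i x y * g i x y) x y)"
    by (rule sum) (auto intro: smooth_cfun_mult assms open_domain)
  also have "\<dots> = (\<Sum>i\<in>I. D (f i) x y * g i x y + f i x y * D (g i) x y)"
    by (rule sum.cong) (auto intro: mult assms)
  finally show ?thesis by (simp add: sum.distrib)
qed

end

lemma derivation_pd:
  assumes "open W"
  shows "derivation W (pd \<alpha>)"
proof
  fix f g :: "'a cfun" and x y c
  show "pd \<alpha> (\<lambda>x y. c) x y = 0" by (cases \<alpha>) (auto simp: pd_def pdx_def pdy_def)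
  assume fg: "smooth_cfun W f" "smooth_cfun W g" and W: "(x, y) \<in> W"
  let ?f = "\<lambda>(x, y). f x y" and ?g = "\<lambda>(x, y). g x y"
  have d: "(?f has_derivative frechet_derivative ?f (at (x, y))) (at (x, y))"
    "(?g has_derivative frechet_derivative ?g (at (x, y))) (at (x, y))"
    using fg W by (auto simp: frechet_derivative_works[symmetric] smooth_cfun_def intro: smooth_on_differentiable)
  show "pd \<alpha> (\<lambda>x y. f x y + g x y) x y = pd \<alpha> f x y + pd \<alpha> g x y"
    unfolding pd_frechet[OF smooth_cfun_add[OF assms fg] W] pd_frechet[OF fg(1) W] pd_frechet[OF fg(2) W]
    using fun_cong[OF frechet_derivative_at[OF has_derivative_add[OF d]], of "pd_dir \<alpha>"]
    by (simp add: case_prod_unfold)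
  show "pd \<alpha> (\<lambda>x y. f x y * g x y) x y = pd \<alpha> f x y * g x y + f x y * pd \<alpha> g x y"
    unfolding pd_frechet[OF smooth_cfun_mult[OF assms fg] W] pd_frechet[OF fg(1) W] pd_frechet[OF fg(2) W]
    using fun_cong[OF frechet_derivative_at[OF has_derivative_mult[OF d]], of "pd_dir \<alpha>"]
    by (simp add: case_prod_unfold)
qed (use assms in \<open>auto intro: smooth_cfun_pd pd_cong\<close>)

lemma derivation_pdx: "open W \<Longrightarrow> derivation W (pdx k)"
  using derivation_pd[of W "Inl k"] by (simp add: pd_def)

lemma derivation_pdy: "open W \<Longrightarrow> derivation W (pdy k)"
  using derivation_pd[of W "Inr k"] by (simp add: pd_def)

lemma pdx_pdx_commute: "open W \<Longrightarrow> smooth_cfun W f \<Longrightarrow> (x, y) \<in> W \<Longrightarrow> pdx j (pdx k f) x y = pdx k (pdx j f) x y"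
  using pd_commute[of W f x y "Inl j" "Inl k"] by (simp add: pd_def)

lemma pdx_pdy_commute: "open W \<Longrightarrow> smooth_cfun W f \<Longrightarrow> (x, y) \<in> W \<Longrightarrow> pdx j (pdy k f) x y = pdy k (pdx j f) x y"
  using pd_commute[of W f x y "Inl j" "Inr k"] by (simp add: pd_def)

lemma pdy_pdy_commute: "open W \<Longrightarrow> smooth_cfun W f \<Longrightarrow> (x, y) \<in> W \<Longrightarrow> pdy j (pdy k f) x y = pdy k (pdy j f) x y"
  using pd_commute[of W f x y "Inr j" "Inr k"] by (simp add: pd_def)

lemma pdy_coord: "pdy k (\<lambda>x y. y $ j) x y = (if j = k then 1 else 0)"
proof -
  have "((\<lambda>t. (y + t *\<^sub>R axis k 1) $ j) has_real_derivative (if j = k then 1 else 0)) (at 0)"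
    by (auto intro!: derivative_eq_intros simp: axis_def)
  then show ?thesis unfolding pdy_def by (rule DERIV_imp_deriv)
qed

lemma pdx_coord: "pdx k (\<lambda>x y. y $ j) x y = 0"
  by (simp add: pdx_def)

lemma pdy_base: "pdy k (\<lambda>x y. h x) x y = 0"
  by (simp add: pdy_def)

text \<open>The vector field with component functions \<open>a i\<close> with respect to the derivations \<open>D i\<close>.\<close>

definition combination :: "('i \<Rightarrow> 'n cfun) \<Rightarrow> ('i \<Rightarrow> 'n cfun \<Rightarrow> 'n cfun) \<Rightarrow> 'n::finite cfun \<Rightarrow> 'n cfun" where
  "combination a D f = (\<lambda>x y. \<Sum>i\<in>UNIV. a i x y * D i f x y)"

lemma derivation_combination:
  assumes "open W" "\<And>i. derivation W (D i)" "\<And>i. smooth_cfun W (a i)"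
  shows "derivation W (combination a D)"
proof -
  interpret derivation W "D i" for i by fact
  show ?thesis
  proof
    fix f g :: "'a cfun" and x y c
    show "smooth_cfun W f \<Longrightarrow> smooth_cfun W (combination a D f)"
      unfolding combination_def
      by (intro smooth_cfun_sum smooth_cfun_mult assms smooth)
    assume W: "(x, y) \<in> W"
    show "combination a D (\<lambda>x y. c) x y = 0"
      using W by (simp add: combination_def const)
    {
      assume "\<And>x y. (x, y) \<in> W \<Longrightarrow> f x y = g x y"
      then have "D i f x y = D i g x y" for i by (rule cong[OF _ W])
      then show "combination a D f x y = combination a D g x y" by (simp add: combination_def)
    }
    assume "smooth_cfun W f" "smooth_cfun W g"
    with W show "combination a D (\<lambda>x y. f x y + g x y) x y = combination a D f x y + combination a D g x y"
      and "combination a D (\<lambda>x y. f x y * g x y) x y = combination a D f x y * g x y + f x y * combination a D g x y"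
      by (simp_all add: combination_def add mult sum.distrib sum_distrib_left sum_distrib_right algebra_simps)
  qed fact
qed

text \<open>The bracket of two vector fields: the second derivatives of \<open>f\<close> cancel because the \<open>D i\<close>
  commute.\<close>

lemma combination_commutator:
  assumes "open W" "\<And>i. derivation W (D i)"
    and comm: "\<And>i j f x y. smooth_cfun W f \<Longrightarrow> (x, y) \<in> W \<Longrightarrow> D i (D j f) x y = D j (D i f) x y"
    and a: "\<And>i. smooth_cfun W (a i)" and b: "\<And>i. smooth_cfun W (b i)"
    and f: "smooth_cfun W f" and W: "(x, y) \<in> W"
  shows "combination a D (combination b D f) x y - combination b D (combination a D f) x y
    = (\<Sum>i\<in>UNIV. (combination a D (b i) x y - combination b D (a i) x y) * D i f x y)"
proof -
  interpret derivation W "D i" for i by fact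
  interpret a: derivation W "combination a D" by (rule derivation_combination; fact)
  interpret b: derivation W "combination b D" by (rule derivation_combination; fact)
  have "combination a D (combination b D f) x y
      = (\<Sum>i\<in>UNIV. combination a D (b i) x y * D i f x y) + (\<Sum>i\<in>UNIV. b i x y * combination a D (D i f) x y)"
    unfolding combination_def[of b D f] by (rule a.sum_mult) (use b smooth[OF f] W in auto)
  moreover have "combination b D (combination a D f) x y
      = (\<Sum>i\<in>UNIV. combination b D (a i) x y * D i f x y) + (\<Sum>i\<in>UNIV. a i x y * combination b D (D i f) x y)"
    unfolding combination_def[of a D f] by (rule b.sum_mult) (use a smooth[OF f] W in auto)
  moreover have "(\<Sum>i\<in>UNIV. b i x y * combination a D (D i f) x y) = (\<Sum>i\<in>UNIV. a i x y * combination b D (D i f) x y)"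
    unfolding combination_def sum_distrib_left
    by (subst sum.swap) (intro sum.cong refl, simp add: comm[OF f W])
  ultimately show ?thesis by (simp add: sum_subtractf left_diff_distrib)
qed

section \<open>Traces of derivatives of the metric\<close>

lemma sum_UNIV_delta:
  fixes f :: "'n::finite \<Rightarrow> real"
  shows "(\<Sum>k\<in>UNIV. (if k = j then 1 else 0) * f k) = f j" "(\<Sum>k\<in>UNIV. (if j = k then 1 else 0) * f k) = f j"
    "(\<Sum>k\<in>UNIV. f k * (if k = j then 1 else 0)) = f j" "(\<Sum>k\<in>UNIV. f k * (if j = k then 1 else 0)) = f j"
proof -
  have *: "(if P then 1 else 0) * c = (if P then c else 0)" "c * (if P then 1 else 0) = (if P then c else 0)"
    for P and c :: real by auto
  show "(\<Sum>k\<in>UNIV. (if k = j then 1 else 0) * f k) = f j" "(\<Sum>k\<in>UNIV. (if j = k then 1 else 0) * f k) = f j"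
    "(\<Sum>k\<in>UNIV. f k * (if k = j then 1 else 0)) = f j" "(\<Sum>k\<in>UNIV. f k * (if j = k then 1 else 0)) = f j"
    unfolding * by simp_all
qed

text \<open>If \<open>h\<close> is the inverse of \<open>g\<close> and \<open>D\<close> is a derivation, this is \<open>D (ln (sqrt (det g)))\<close> by Jacobi's
  formula. Working with the trace avoids differentiating the determinant.\<close>

definition half_trace :: "('n \<Rightarrow> 'n \<Rightarrow> 'n cfun) \<Rightarrow> ('n \<Rightarrow> 'n \<Rightarrow> 'n cfun) \<Rightarrow> ('n cfun \<Rightarrow> 'n cfun) \<Rightarrow> 'n::finite cfun" where
  "half_trace h g D = (\<lambda>x y. 1/2 * (\<Sum>j\<in>UNIV. \<Sum>k\<in>UNIV. h j k x y * D (g j k) x y))"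

lemma (in derivation) smooth_half_trace:
  assumes "\<And>j k. smooth_cfun W (g j k)" "\<And>j k. smooth_cfun W (h j k)"
  shows "smooth_cfun W (half_trace h g D)"
  unfolding half_trace_def
  by (intro smooth_cfun_mult smooth_cfun_sum smooth_cfun_const open_domain smooth assms)

text \<open>From \<open>g h = 1\<close> one gets \<open>(D g) h + g (D h) = 0\<close>, that is \<open>D h = - h (D g) h\<close>.\<close>

lemma (in derivation) derivative_of_inverse:
  fixes g h :: "'n \<Rightarrow> 'n \<Rightarrow> 'n cfun"
  assumes g: "\<And>j k. smooth_cfun W (g j k)" and h: "\<And>j k. smooth_cfun W (h j k)"
    and gh: "\<And>a c x y. (x, y) \<in> W \<Longrightarrow> (\<Sum>b\<in>UNIV. g a b x y * h b c x y) = (if a = c then 1 else 0)"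
    and hg: "\<And>a c x y. (x, y) \<in> W \<Longrightarrow> (\<Sum>b\<in>UNIV. h a b x y * g b c x y) = (if a = c then 1 else 0)"
    and W: "(x, y) \<in> W"
  shows "D (h j k) x y = - (\<Sum>a\<in>UNIV. \<Sum>b\<in>UNIV. h j a x y * D (g a b) x y * h b k x y)"
proof -
  have "(\<Sum>b\<in>UNIV. D (g a b) x y * h b k x y) + (\<Sum>b\<in>UNIV. g a b x y * D (h b k) x y) = 0" for a
  proof -
    have "D (\<lambda>x y. \<Sum>b\<in>UNIV. g a b x y * h b k x y) x y = D (\<lambda>x y. if a = k then 1 else 0) x y"
      by (rule cong[OF gh W])
    then show ?thesis using sum_mult[of UNIV "g a" "\<lambda>b. h b k" x y] g h W by (simp add: const)
  qed
  then have *: "(\<Sum>b\<in>UNIV. D (g a b) x y * h b k x y) = - (\<Sum>b\<in>UNIV. g a b x y * D (h b k) x y)" for a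
    by (simp add: eq_neg_iff_add_eq_0)
  have "(\<Sum>a\<in>UNIV. \<Sum>b\<in>UNIV. h j a x y * D (g a b) x y * h b k x y)
      = (\<Sum>a\<in>UNIV. h j a x y * (\<Sum>b\<in>UNIV. D (g a b) x y * h b k x y))"
    by (simp add: sum_distrib_left mult.assoc)
  also have "\<dots> = - (\<Sum>a\<in>UNIV. \<Sum>b\<in>UNIV. h j a x y * g a b x y * D (h b k) x y)"
    unfolding * by (simp add: sum_distrib_left sum_negf mult.assoc)
  also have "\<dots> = - (\<Sum>b\<in>UNIV. (\<Sum>a\<in>UNIV. h j a x y * g a b x y) * D (h b k) x y)"
    by (subst sum.swap) (simp add: sum_distrib_right)
  also have "\<dots> = - D (h j k) x y"
    using sum_UNIV_delta(2)[of j "\<lambda>b. D (h b k) x y"] by (simp only: hg[OF W])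
  finally show ?thesis by simp
qed

lemma sum_swap_pairs:
  "(\<Sum>j\<in>A. \<Sum>k\<in>B. \<Sum>a\<in>A. \<Sum>b\<in>B. F j k a b) = (\<Sum>j\<in>A. \<Sum>k\<in>B. \<Sum>a\<in>A. \<Sum>b\<in>B. F a b j k)"
proof -
  have "(\<Sum>j\<in>A. \<Sum>k\<in>B. \<Sum>a\<in>A. \<Sum>b\<in>B. F j k a b) = (\<Sum>p\<in>A\<times>B. \<Sum>q\<in>A\<times>B. F (fst p) (snd p) (fst q) (snd q))"
    by (simp only: sum.cartesian_product' fst_conv snd_conv)
  also have "\<dots> = (\<Sum>q\<in>A\<times>B. \<Sum>p\<in>A\<times>B. F (fst p) (snd p) (fst q) (snd q))"
    by (rule sum.swap)
  also have "\<dots> = (\<Sum>j\<in>A. \<Sum>k\<in>B. \<Sum>a\<in>A. \<Sum>b\<in>B. F a b j k)"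
    by (simp only: sum.cartesian_product' fst_conv snd_conv)
  finally show ?thesis .
qed

text \<open>In terms of \<open>f = ln (sqrt (det g))\<close> this is the definition of the commutator,
  \<open>D (D' f) - D' (D f) = [D, D'] f\<close>. Differentiating the inverse metric contributes the trace of
  \<open>h (D g) h (D' g)\<close>, which is symmetric in \<open>D\<close> and \<open>D'\<close> and therefore drops out.\<close>

lemma half_trace_commutator:
  fixes g h :: "'n::finite \<Rightarrow> 'n \<Rightarrow> 'n cfun"
  assumes D: "derivation W D" and D': "derivation W D'"
    and g: "\<And>j k. smooth_cfun W (g j k)" and h: "\<And>j k. smooth_cfun W (h j k)"
    and sym: "\<And>j k x y. (x, y) \<in> W \<Longrightarrow> h j k x y = h k j x y"
    and gh: "\<And>a c x y. (x, y) \<in> W \<Longrightarrow> (\<Sum>b\<in>UNIV. g a b x y * h b c x y) = (if a = c then 1 else 0)"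
    and hg: "\<And>a c x y. (x, y) \<in> W \<Longrightarrow> (\<Sum>b\<in>UNIV. h a b x y * g b c x y) = (if a = c then 1 else 0)"
    and W: "(x, y) \<in> W"
  shows "D (half_trace h g D') x y - D' (half_trace h g D) x y
      = half_trace h g (\<lambda>f x y. D (D' f) x y - D' (D f) x y) x y"
proof -
  define Q where "Q D D' = (\<Sum>j\<in>UNIV. \<Sum>k\<in>UNIV. \<Sum>a\<in>UNIV. \<Sum>b\<in>UNIV.
      h j a x y * D (g a b) x y * h b k x y * D' (g j k) x y)" for D D' :: "'n cfun \<Rightarrow> 'n cfun"
  have expand: "D (half_trace h g D') x y
      = 1/2 * ((\<Sum>j\<in>UNIV. \<Sum>k\<in>UNIV. h j k x y * D (D' (g j k)) x y) - Q D D')"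
    if "derivation W D" "derivation W D'" for D D'
  proof -
    interpret D: derivation W D by fact
    interpret D': derivation W D' by fact
    have "D (half_trace h g D') x y = 1/2 * D (\<lambda>x y. \<Sum>j\<in>UNIV. \<Sum>k\<in>UNIV. h j k x y * D' (g j k) x y) x y"
      unfolding half_trace_def
      by (rule D.cmult) (auto intro!: smooth_cfun_sum smooth_cfun_mult D.open_domain g h D'.smooth W)
    also have "D (\<lambda>x y. \<Sum>j\<in>UNIV. \<Sum>k\<in>UNIV. h j k x y * D' (g j k) x y) x y
        = (\<Sum>j\<in>UNIV. D (\<lambda>x y. \<Sum>k\<in>UNIV. h j k x y * D' (g j k) x y) x y)"
      by (rule D.sum) (auto intro!: smooth_cfun_sum smooth_cfun_mult D.open_domain g h D'.smooth W)
    also have "\<dots> = (\<Sum>j\<in>UNIV. \<Sum>k\<in>UNIV. D (h j k) x y * D' (g j k) x y)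
        + (\<Sum>j\<in>UNIV. \<Sum>k\<in>UNIV. h j k x y * D (D' (g j k)) x y)"
      by (simp add: D.sum_mult g h D'.smooth W sum.distrib)
    also have "(\<Sum>j\<in>UNIV. \<Sum>k\<in>UNIV. D (h j k) x y * D' (g j k) x y) = - Q D D'"
      unfolding Q_def by (simp add: D.derivative_of_inverse[of g h, OF g h gh hg W] sum_distrib_right sum_negf)
    finally show ?thesis by simp
  qed
  have "Q D D' = (\<Sum>j\<in>UNIV. \<Sum>k\<in>UNIV. \<Sum>a\<in>UNIV. \<Sum>b\<in>UNIV.
      h a j x y * D (g j k) x y * h k b x y * D' (g a b) x y)"
    unfolding Q_def by (rule sum_swap_pairs)
  also have "\<dots> = Q D' D"
    unfolding Q_def
  proof (intro sum.cong refl)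
    fix j k a b
    show "h a j x y * D (g j k) x y * h k b x y * D' (g a b) x y
        = h j a x y * D' (g a b) x y * h b k x y * D (g j k) x y"
      using sym[OF W, of a j] sym[OF W, of k b] by simp
  qed
  finally show ?thesis
    unfolding expand[OF D D'] expand[OF D' D]
    by (simp add: half_trace_def right_diff_distrib sum_subtractf)
qed

section \<open>Euler's relation\<close>

definition euler_field :: "'n::finite cfun \<Rightarrow> 'n cfun" where
  "euler_field = combination (\<lambda>k x y. y $ k) pdy"

lemma euler_field_eq: "euler_field f x y = (\<Sum>k\<in>UNIV. y $ k * pdy k f x y)"
  by (simp add: euler_field_def combination_def)

lemma derivation_euler_field: "open W \<Longrightarrow> derivation W euler_field"
  unfolding euler_field_def
  by (intro derivation_combination derivation_pdy smooth_cfun_snd)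

text \<open>Differentiate \<open>f x ((1 + t) y) = (1 + t) ^ m f x y\<close> at \<open>t = 0\<close>.\<close>

lemma euler_field_homogeneous:
  assumes f: "smooth_cfun W f" and W: "(x, y) \<in> W"
    and hom: "\<And>a. a > 0 \<Longrightarrow> f x (a *\<^sub>R y) = a ^ m * f x y"
  shows "euler_field f x y = of_nat m * f x y"
proof -
  let ?d = "frechet_derivative (\<lambda>(x, y). f x y) (at (x, y))"
  have lin: "linear ?d"
    using f W by (intro linear_frechet_derivative) (auto simp: smooth_cfun_def intro: smooth_on_differentiable)
  have "(0, y) = (\<Sum>k\<in>UNIV. y $ k *\<^sub>R (0 :: real^'a, axis k 1 :: real^'a))"
    using basis_expansion[of y] by (simp add: sum_prod scalar_mult_eq_scaleR)
  then have "?d (0, y) = (\<Sum>k\<in>UNIV. y $ k * ?d (0, axis k 1))"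
    by (simp only: linear_sum[OF lin] linear_scale[OF lin] real_scaleR_def)
  then have "?d (0, y) = euler_field f x y"
    by (simp add: euler_field_eq pdy_frechet[OF f W])
  with has_real_derivative_along[OF f W, of 0 y]
  have 1: "((\<lambda>t. f x (y + t *\<^sub>R y)) has_real_derivative euler_field f x y) (at 0)" by simp
  have "((\<lambda>t. (1 + t) ^ m * f x y) has_real_derivative of_nat m * f x y) (at 0)"
    by (auto intro!: derivative_eq_intros)
  then have "((\<lambda>t. f x (y + t *\<^sub>R y)) has_real_derivative of_nat m * f x y) (at 0)"
  proof (rule has_field_derivative_transform_within_open)
    show "(1 + t) ^ m * f x y = f x (y + t *\<^sub>R y)" if "t \<in> {-1<..}" for t
      using hom[of "1 + t"] that by (simp add: algebra_simps)
  qed auto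
  from DERIV_unique[OF 1 this] show ?thesis .
qed

text \<open>A fibre derivative lowers the degree of homogeneity by one because \<open>[\<partial>/\<partial>y\<^sup>l, C] = \<partial>/\<partial>y\<^sup>l\<close> for
  the Euler field \<open>C\<close>; a base derivative commutes with \<open>C\<close> and preserves the degree.\<close>

lemma euler_field_pdy:
  assumes "open W" and f: "smooth_cfun W f"
    and eu: "\<And>x y. (x, y) \<in> W \<Longrightarrow> euler_field f x y = m * f x y"
    and W: "(x, y) \<in> W"
  shows "euler_field (pdy l f) x y = (m - 1) * pdy l f x y"
proof -
  interpret derivation W "pdy k" for k by (rule derivation_pdy) fact
  have "m * pdy l f x y = pdy l (\<lambda>x y. m * f x y) x y"
    using f W by (simp add: cmult)
  also have "\<dots> = pdy l (euler_field f) x y"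
    using W by (intro cong) (simp_all add: eu)
  also have "\<dots> = pdy l f x y + euler_field (pdy l f) x y"
    unfolding euler_field_eq[abs_def]
    using f W
    by (subst sum_mult) (auto simp: smooth_cfun_snd smooth pdy_coord sum_UNIV_delta pdy_pdy_commute[OF open_domain f W])
  finally show ?thesis by (simp add: algebra_simps)
qed

lemma euler_field_pdx:
  assumes "open W" and f: "smooth_cfun W f"
    and eu: "\<And>x y. (x, y) \<in> W \<Longrightarrow> euler_field f x y = m * f x y"
    and W: "(x, y) \<in> W"
  shows "euler_field (pdx l f) x y = m * pdx l f x y"
proof -
  interpret derivation W "pdx k" for k by (rule derivation_pdx) fact
  interpret y: derivation W "pdy k" for k by (rule derivation_pdy) fact
  have "m * pdx l f x y = pdx l (\<lambda>x y. m * f x y) x y"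
    using f W by (simp add: cmult)
  also have "\<dots> = pdx l (euler_field f) x y"
    using W by (intro cong) (simp_all add: eu)
  also have "\<dots> = euler_field (pdx l f) x y"
    unfolding euler_field_eq[abs_def]
    using f W
    by (subst sum_mult) (auto simp: smooth_cfun_snd y.smooth pdx_coord pdx_pdy_commute[OF open_domain f W])
  finally show ?thesis by simp
qed

section \<open>Finsler geometry in one chart\<close>

text \<open>The coordinate expression \<open>L\<close> of a Finsler structure over the image \<open>U\<close> of a chart.\<close>

locale finsler_chart =
  fixes U :: "(real^'n::finite) set" and L :: "'n cfun"
  assumes open_U: "open U"
    and smooth_L: "smooth_cfun (U \<times> (UNIV - {0})) L"
    and homogeneous_L: "x \<in> U \<Longrightarrow> y \<noteq> 0 \<Longrightarrow> a > 0 \<Longrightarrow> L x (a *\<^sub>R y) = a * L x y"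
    and positive: "x \<in> U \<Longrightarrow> y \<noteq> 0 \<Longrightarrow> v \<noteq> 0 \<Longrightarrow> v \<bullet> (gmat L x y *v v) > 0"
begin

definition W where "W = U \<times> (UNIV - {0 :: real^'n})"

definition energy :: "'n cfun" where "energy = (\<lambda>x y. (L x y)\<^sup>2 / 2)"

lemma open_W: "open W"
  unfolding W_def by (intro open_Times open_U open_Diff) auto

sublocale dx: derivation W "pdx k" for k by (rule derivation_pdx[OF open_W])
sublocale dy: derivation W "pdy k" for k by (rule derivation_pdy[OF open_W])
sublocale eu: derivation W euler_field by (rule derivation_euler_field[OF open_W])

lemmas smooth_intros = smooth_cfun_const smooth_cfun_snd smooth_cfun_add[OF open_W]
  smooth_cfun_mult[OF open_W] smooth_cfun_minus[OF open_W] smooth_cfun_diff[OF open_W]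
  smooth_cfun_sum[OF open_W] dx.smooth dy.smooth eu.smooth

lemmas comm = pdx_pdx_commute[OF open_W] pdx_pdy_commute[OF open_W] pdy_pdy_commute[OF open_W]

lemma smooth_energy: "smooth_cfun W energy"
proof -
  have "smooth_cfun W (\<lambda>x y. L x y ^ 2 / 2)"
    by (intro smooth_cfun_divide smooth_cfun_power smooth_cfun_const open_W)
      (use smooth_L in \<open>auto simp: W_def\<close>)
  then show ?thesis by (simp add: energy_def)
qed

lemma euler_energy: "(x, y) \<in> W \<Longrightarrow> euler_field energy x y = 2 * energy x y"
  using euler_field_homogeneous[OF smooth_energy, of x y 2] homogeneous_L
  by (simp add: W_def energy_def power_mult_distrib)

lemma euler_momentum: "(x, y) \<in> W \<Longrightarrow> euler_field (pdy l energy) x y = pdy l energy x y"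
  using euler_field_pdy[OF open_W smooth_energy euler_energy] by simp

lemma g_low_eq: "g_low L i j = pdy j (pdy i energy)"
  by (simp add: g_low_def gmat_def energy_def fun_eq_iff)

lemma smooth_g_low: "smooth_cfun W (g_low L i j)"
  unfolding g_low_eq by (intro smooth_intros smooth_energy)

lemma g_low_sym: "(x, y) \<in> W \<Longrightarrow> g_low L i j x y = g_low L j i x y"
  unfolding g_low_eq by (intro comm smooth_energy)

lemma euler_g_low: "(x, y) \<in> W \<Longrightarrow> euler_field (g_low L i j) x y = 0"
  using euler_field_pdy[OF open_W dy.smooth[OF smooth_energy], of i 1] euler_momentum
  by (simp add: g_low_eq)

lemma gmat_invertible:
  assumes "(x, y) \<in> W" shows "invertible (gmat L x y)"
proof -
  have "\<forall>v. gmat L x y *v v = 0 \<longrightarrow> v = 0"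
    using positive[of x y] assms by (force simp: W_def)
  then show ?thesis
    unfolding invertible_left_inverse matrix_left_invertible_ker .
qed

lemma smooth_g_up: "smooth_cfun W (g_up L i j)"
  using smooth_cfun_matrix_inv[OF open_W smooth_g_low[unfolded g_low_def] gmat_invertible]
  by (simp add: g_up_def)

lemma
  assumes "(x, y) \<in> W"
  shows g_low_g_up: "(\<Sum>b\<in>UNIV. g_low L a b x y * g_up L b c x y) = (if a = c then 1 else 0)"
    and g_up_g_low: "(\<Sum>b\<in>UNIV. g_up L a b x y * g_low L b c x y) = (if a = c then 1 else 0)"
proof -
  have "gmat L x y ** matrix_inv (gmat L x y) = mat 1 \<and> matrix_inv (gmat L x y) ** gmat L x y = mat 1"
    using gmat_invertible[OF assms] unfolding invertible_def matrix_inv_def by (rule someI_ex)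
  then have "(gmat L x y ** matrix_inv (gmat L x y)) $ a $ c = mat 1 $ a $ c"
    "(matrix_inv (gmat L x y) ** gmat L x y) $ a $ c = mat 1 $ a $ c" by simp_all
  then show "(\<Sum>b\<in>UNIV. g_low L a b x y * g_up L b c x y) = (if a = c then 1 else 0)"
    "(\<Sum>b\<in>UNIV. g_up L a b x y * g_low L b c x y) = (if a = c then 1 else 0)"
    by (simp_all add: matrix_matrix_mult_def mat_def g_low_def g_up_def)
qed

text \<open>Lowering an index is injective, and this is how equations for the spray coefficients are solved.\<close>

lemma raise_lowered:
  assumes "(x, y) \<in> W"
  shows "(\<Sum>l\<in>UNIV. g_up L r l x y * (\<Sum>i\<in>UNIV. g_low L l i x y * u i)) = u r"
proof -
  have "(\<Sum>l\<in>UNIV. g_up L r l x y * (\<Sum>i\<in>UNIV. g_low L l i x y * u i))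
      = (\<Sum>i\<in>UNIV. (\<Sum>l\<in>UNIV. g_up L r l x y * g_low L l i x y) * u i)"
    unfolding sum_distrib_left sum_distrib_right
    by (subst sum.swap) (simp add: mult.assoc)
  then show ?thesis by (simp only: g_up_g_low[OF assms] sum_UNIV_delta)
qed

lemma g_up_sym:
  assumes W: "(x, y) \<in> W" shows "g_up L i j x y = g_up L j i x y"
proof -
  have "g_up L i j x y = (\<Sum>l\<in>UNIV. g_up L i l x y * (\<Sum>m\<in>UNIV. g_low L l m x y * g_up L j m x y))"
  proof -
    have "(\<Sum>m\<in>UNIV. g_low L l m x y * g_up L j m x y) = (\<Sum>m\<in>UNIV. g_up L j m x y * g_low L m l x y)" for l
      by (intro sum.cong refl) (simp add: g_low_sym[OF W, of l])
    then show ?thesis by (simp only: g_up_g_low[OF W] sum_UNIV_delta)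
  qed
  also have "\<dots> = g_up L j i x y" by (rule raise_lowered[OF W])
  finally show ?thesis .
qed

text \<open>The covector \<open>2 g\<^sub>l\<^sub>i G\<^sup>i\<close>. Unlike \<open>G\<^sup>i\<close> it does not involve the inverse metric, so the spray
  is differentiated through it.\<close>

definition lowered_spray :: "'n \<Rightarrow> 'n cfun" where
  "lowered_spray l = (\<lambda>x y. (\<Sum>k\<in>UNIV. y $ k * pdx k (pdy l energy) x y) - pdx l energy x y)"

lemma smooth_lowered_spray: "smooth_cfun W (lowered_spray l)"
  unfolding lowered_spray_def by (intro smooth_intros smooth_energy)

lemma spray_eq:
  assumes W: "(x, y) \<in> W"
  shows "spray L i x y = 1/2 * (\<Sum>l\<in>UNIV. g_up L i l x y * lowered_spray l x y)"
proof -
  have sq: "(\<lambda>x y. (L x y)\<^sup>2) = (\<lambda>x y. 2 * energy x y)" by (simp add: energy_def)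
  have p: "pdx k (\<lambda>x y. (L x y)\<^sup>2) x y = 2 * pdx k energy x y" if "(x, y) \<in> W" for x y k
    unfolding sq by (rule dx.cmult[OF smooth_energy that])
  have q: "pdy l (pdx k (\<lambda>x y. (L x y)\<^sup>2)) x y = 2 * pdx k (pdy l energy) x y" for l k
  proof -
    have "pdy l (pdx k (\<lambda>x y. (L x y)\<^sup>2)) x y = pdy l (\<lambda>x y. 2 * pdx k energy x y) x y"
      by (rule dy.cong[OF p W])
    then show ?thesis by (simp add: dy.cmult[OF dx.smooth[OF smooth_energy] W] comm(2)[OF smooth_energy W])
  qed
  have r: "(\<Sum>k\<in>UNIV. pdy l (pdx k (\<lambda>x y. (L x y)\<^sup>2)) x y * y $ k) - pdx l (\<lambda>x y. (L x y)\<^sup>2) x y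
      = 2 * lowered_spray l x y" for l
    unfolding q p[OF W] lowered_spray_def by (simp add: sum_distrib_left right_diff_distrib mult_ac)
  show ?thesis unfolding spray_def r by (simp add: sum_distrib_left algebra_simps)
qed

lemma smooth_spray: "smooth_cfun W (spray L i)"
proof (rule smooth_cfun_cong[OF open_W])
  show "smooth_cfun W (\<lambda>x y. 1/2 * (\<Sum>l\<in>UNIV. g_up L i l x y * lowered_spray l x y))"
    by (intro smooth_intros smooth_g_up smooth_lowered_spray)
qed (simp add: spray_eq)

lemma g_low_spray:
  assumes W: "(x, y) \<in> W"
  shows "(\<Sum>i\<in>UNIV. g_low L l i x y * spray L i x y) = 1/2 * lowered_spray l x y"
proof -
  have "(\<Sum>i\<in>UNIV. g_low L l i x y * spray L i x y)
      = 1/2 * (\<Sum>m\<in>UNIV. (\<Sum>i\<in>UNIV. g_low L l i x y * g_up L i m x y) * lowered_spray m x y)"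
    unfolding spray_eq[OF W] sum_distrib_left sum_distrib_right
    by (subst sum.swap) (simp add: mult_ac)
  then show ?thesis by (simp only: g_low_g_up[OF W] sum_UNIV_delta)
qed

lemma euler_lowered_spray:
  assumes W: "(x, y) \<in> W" shows "euler_field (lowered_spray l) x y = 2 * lowered_spray l x y"
proof -
  have "euler_field (\<lambda>x y. y $ k) x y = y $ k" for k
    by (simp add: euler_field_eq pdy_coord sum_UNIV_delta)
  moreover have "euler_field (pdx k (pdy l energy)) x y = pdx k (pdy l energy) x y" for k
    using euler_field_pdx[OF open_W dy.smooth[OF smooth_energy], of l 1] euler_momentum W by simp
  moreover have "euler_field (pdx l energy) x y = 2 * pdx l energy x y"
    using euler_field_pdx[OF open_W smooth_energy euler_energy W] .
  ultimately show ?thesis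
    unfolding lowered_spray_def using W
    by (subst eu.diff, (intro smooth_intros smooth_energy)+)
      (auto simp: eu.sum_mult smooth_intros smooth_energy)
qed

text \<open>\<open>g\<close> has degree 0 and the lowered spray degree 2, so the degree of \<open>G\<^sup>i\<close> is 2.\<close>

lemma euler_spray:
  assumes W: "(x, y) \<in> W" shows "euler_field (spray L i) x y = 2 * spray L i x y"
proof -
  have "(\<Sum>i\<in>UNIV. g_low L l i x y * euler_field (spray L i) x y) = lowered_spray l x y" for l
  proof -
    have "euler_field (\<lambda>x y. \<Sum>i\<in>UNIV. g_low L l i x y * spray L i x y) x y
        = euler_field (\<lambda>x y. 1/2 * lowered_spray l x y) x y"
      by (rule eu.cong[OF g_low_spray W])
    then show ?thesis
      by (simp add: eu.sum_mult eu.cmult smooth_g_low smooth_spray smooth_lowered_spray W euler_g_low euler_lowered_spray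
          del: times_divide_eq_left)
  qed
  then have "euler_field (spray L i) x y = (\<Sum>l\<in>UNIV. g_up L i l x y * lowered_spray l x y)"
    using raise_lowered[OF W, of i "\<lambda>i. euler_field (spray L i) x y"] by simp
  then show ?thesis by (simp add: spray_eq[OF W])
qed

lemma nonlin_conn_contract:
  "(x, y) \<in> W \<Longrightarrow> (\<Sum>k\<in>UNIV. y $ k * nonlin_conn L i k x y) = 2 * spray L i x y"
  using euler_spray by (simp add: nonlin_conn_def euler_field_eq)

lemma smooth_nonlin_conn: "smooth_cfun W (nonlin_conn L i j)"
  unfolding nonlin_conn_def by (intro smooth_intros smooth_spray)

text \<open>The vector field \<open>S = y\<^sup>k \<partial>/\<partial>x\<^sup>k - 2 G\<^sup>k \<partial>/\<partial>y\<^sup>k\<close> on the slit tangent bundle whose integral curves are the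
  lifts of geodesics.\<close>

definition spray_field :: "'n cfun \<Rightarrow> 'n cfun" where
  "spray_field = combination (case_sum (\<lambda>k x y. y $ k) (\<lambda>k x y. - 2 * spray L k x y)) pd"

lemma sum_UNIV_Plus: "(\<Sum>\<alpha>\<in>UNIV. f \<alpha>) = (\<Sum>k\<in>UNIV. f (Inl k)) + (\<Sum>k\<in>UNIV. f (Inr k))"
  for f :: "'n + 'n \<Rightarrow> real"
  by (simp add: UNIV_Plus_UNIV[symmetric] sum.Plus del: UNIV_Plus_UNIV)

lemma spray_field_eq:
  "spray_field f x y = (\<Sum>k\<in>UNIV. y $ k * pdx k f x y) - 2 * (\<Sum>k\<in>UNIV. spray L k x y * pdy k f x y)"
  by (simp add: spray_field_def combination_def sum_UNIV_Plus pd_def sum_distrib_left mult_ac sum_negf)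

lemma smooth_spray_field_components:
  "smooth_cfun W (case_sum (\<lambda>k x y. y $ k) (\<lambda>k x y. - 2 * spray L k x y) \<alpha>)"
proof (cases \<alpha>)
  case (Inl k)
  show ?thesis unfolding Inl sum.case by (intro smooth_intros)
next
  case (Inr k)
  show ?thesis unfolding Inr sum.case by (intro smooth_intros smooth_spray)
qed

sublocale sp: derivation W spray_field
  unfolding spray_field_def
  by (intro derivation_combination derivation_pd open_W smooth_spray_field_components)

text \<open>The fibre derivative of \<open>2 g\<^sub>l\<^sub>i G\<^sup>i = y\<^sup>k \<partial>\<^sup>2E/\<partial>x\<^sup>k\<partial>y\<^sup>l - \<partial>E/\<partial>x\<^sup>l\<close>. Since the fibre derivative of \<open>g\<close> is
  totally symmetric, the terms that contain \<open>g\<close> combine into \<open>S g\<close>; what remains is antisymmetric.\<close>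

lemma g_low_nonlin_conn:
  assumes W: "(x, y) \<in> W"
  shows "2 * (\<Sum>i\<in>UNIV. g_low L l i x y * nonlin_conn L i j x y)
    = spray_field (g_low L l j) x y + (pdx j (pdy l energy) x y - pdx l (pdy j energy) x y)"
proof -
  have "pdy j (\<lambda>x y. \<Sum>i\<in>UNIV. g_low L l i x y * spray L i x y) x y = pdy j (\<lambda>x y. 1/2 * lowered_spray l x y) x y"
    by (rule dy.cong[OF g_low_spray W])
  then have 1: "(\<Sum>i\<in>UNIV. pdy j (g_low L l i) x y * spray L i x y)
      + (\<Sum>i\<in>UNIV. g_low L l i x y * nonlin_conn L i j x y) = 1/2 * pdy j (lowered_spray l) x y"
    by (simp add: dy.sum_mult dy.cmult smooth_g_low smooth_spray smooth_lowered_spray W nonlin_conn_def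
        del: times_divide_eq_left)
  have 2: "pdy j (lowered_spray l) x y = pdx j (pdy l energy) x y
      + (\<Sum>k\<in>UNIV. y $ k * pdx k (g_low L l j) x y) - pdx l (pdy j energy) x y"
  proof -
    have "pdy j (lowered_spray l) x y = pdx j (pdy l energy) x y
      + (\<Sum>k\<in>UNIV. y $ k * pdy j (pdx k (pdy l energy)) x y) - pdy j (pdx l energy) x y"
    proof -
      have "pdy j (\<lambda>x y. \<Sum>k\<in>UNIV. y $ k * pdx k (pdy l energy) x y) x y
          = (\<Sum>k\<in>UNIV. pdy j (\<lambda>x y. y $ k) x y * pdx k (pdy l energy) x y)
            + (\<Sum>k\<in>UNIV. y $ k * pdy j (pdx k (pdy l energy)) x y)"
        by (intro dy.sum_mult smooth_intros smooth_energy W)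
      moreover have "pdy j (lowered_spray l) x y
          = pdy j (\<lambda>x y. \<Sum>k\<in>UNIV. y $ k * pdx k (pdy l energy) x y) x y - pdy j (pdx l energy) x y"
        unfolding lowered_spray_def by (intro dy.diff smooth_intros smooth_energy W)
      ultimately show ?thesis
        unfolding pdy_coord sum_UNIV_delta by simp
    qed
    then show ?thesis
      by (simp add: g_low_eq comm(2)[OF smooth_energy W] comm(2)[OF dy.smooth[OF smooth_energy] W])
  qed
  have 3: "pdy j (g_low L l i) x y = pdy i (g_low L l j) x y" for i
    unfolding g_low_eq by (intro comm dy.smooth smooth_energy W)
  from 1 show ?thesis unfolding 2 3 spray_field_eq by (simp add: mult_ac)
qed

text \<open>\<open>N\<^sup>r\<^sub>r = S (ln (sqrt (det g)))\<close>: the antisymmetric part in the previous formula is killed by the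
  contraction with the inverse metric.\<close>

lemma nonlin_conn_trace:
  assumes W: "(x, y) \<in> W"
  shows "(\<Sum>r\<in>UNIV. nonlin_conn L r r x y) = half_trace (g_up L) (g_low L) spray_field x y"
proof -
  let ?A = "\<lambda>l j. pdx j (pdy l energy) x y - pdx l (pdy j energy) x y"
  have "2 * nonlin_conn L r r x y = (\<Sum>l\<in>UNIV. g_up L r l x y * (spray_field (g_low L l r) x y + ?A l r))" for r
    using raise_lowered[OF W, of r "\<lambda>i. 2 * nonlin_conn L i r x y"]
    by (simp only: mult.left_commute[of _ 2] sum_distrib_left[symmetric] g_low_nonlin_conn[OF W])
  then have "2 * (\<Sum>r\<in>UNIV. nonlin_conn L r r x y)
      = (\<Sum>r\<in>UNIV. \<Sum>l\<in>UNIV. g_up L r l x y * spray_field (g_low L l r) x y)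
        + (\<Sum>r\<in>UNIV. \<Sum>l\<in>UNIV. g_up L r l x y * ?A l r)"
    by (simp add: sum_distrib_left distrib_left sum.distrib)
  moreover have "(\<Sum>r\<in>UNIV. \<Sum>l\<in>UNIV. g_up L r l x y * ?A l r) = 0"
  proof -
    have "(\<Sum>r\<in>UNIV. \<Sum>l\<in>UNIV. g_up L r l x y * ?A l r) = (\<Sum>r\<in>UNIV. \<Sum>l\<in>UNIV. g_up L l r x y * ?A r l)"
      by (rule sum.swap)
    also have "\<dots> = - (\<Sum>r\<in>UNIV. \<Sum>l\<in>UNIV. g_up L r l x y * ?A l r)"
      unfolding sum_negf[symmetric]
      by (intro sum.cong refl) (simp add: g_up_sym[OF W] right_diff_distrib)
    finally show ?thesis by simp
  qed
  moreover have "spray_field (g_low L l r) x y = spray_field (g_low L r l) x y" for l r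
    by (rule sp.cong[OF g_low_sym W])
  ultimately show ?thesis by (simp add: half_trace_def)
qed

lemma delta_x_contract:
  assumes W: "(x, y) \<in> W"
  shows "(\<Sum>k\<in>UNIV. y $ k * delta_x L k f x y) = spray_field f x y"
proof -
  have "(\<Sum>k\<in>UNIV. y $ k * delta_x L k f x y) = (\<Sum>k\<in>UNIV. y $ k * pdx k f x y)
      - (\<Sum>k\<in>UNIV. \<Sum>j\<in>UNIV. y $ k * nonlin_conn L j k x y * pdy j f x y)"
    by (simp add: delta_x_def right_diff_distrib sum_subtractf sum_distrib_left mult.assoc)
  also have "(\<Sum>k\<in>UNIV. \<Sum>j\<in>UNIV. y $ k * nonlin_conn L j k x y * pdy j f x y)
      = (\<Sum>j\<in>UNIV. (\<Sum>k\<in>UNIV. y $ k * nonlin_conn L j k x y) * pdy j f x y)"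
    by (subst sum.swap) (simp add: sum_distrib_right)
  finally show ?thesis
    by (simp add: nonlin_conn_contract[OF W] spray_field_eq sum_distrib_left mult.assoc)
qed

text \<open>Homogeneity gives \<open>y\<^sup>k g\<^sub>l\<^sub>k = \<partial>E/\<partial>y\<^sup>l\<close> and makes the fibre derivatives of \<open>g\<close> vanish on contraction with
  \<open>y\<close>, so only the base derivative in \<open>\<delta>/\<delta>x\<^sup>i\<close> contributes.\<close>

lemma delta_g_low_contract:
  assumes W: "(x, y) \<in> W"
  shows "(\<Sum>k\<in>UNIV. y $ k * delta_x L i (g_low L l k) x y) = pdx i (pdy l energy) x y"
proof -
  have 1: "(\<Sum>k\<in>UNIV. y $ k * pdx i (g_low L l k) x y) = pdx i (pdy l energy) x y"
    using euler_field_pdx[OF open_W dy.smooth[OF smooth_energy], of l 1 x y i] euler_momentum W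
    by (simp add: euler_field_eq g_low_eq comm(2)[OF dy.smooth[OF smooth_energy] W])
  have 2: "(\<Sum>k\<in>UNIV. y $ k * pdy m (g_low L l k) x y) = 0" for m
    using euler_g_low[OF W, of l m]
    by (simp add: euler_field_eq g_low_eq comm(3)[OF dy.smooth[OF smooth_energy] W, of _ m])
  have "(\<Sum>k\<in>UNIV. y $ k * delta_x L i (g_low L l k) x y) = (\<Sum>k\<in>UNIV. y $ k * pdx i (g_low L l k) x y)
      - (\<Sum>k\<in>UNIV. \<Sum>m\<in>UNIV. nonlin_conn L m i x y * (y $ k * pdy m (g_low L l k) x y))"
    by (simp add: delta_x_def right_diff_distrib sum_subtractf sum_distrib_left mult_ac)
  also have "(\<Sum>k\<in>UNIV. \<Sum>m\<in>UNIV. nonlin_conn L m i x y * (y $ k * pdy m (g_low L l k) x y))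
      = (\<Sum>m\<in>UNIV. nonlin_conn L m i x y * (\<Sum>k\<in>UNIV. y $ k * pdy m (g_low L l k) x y))"
    by (subst sum.swap) (simp add: sum_distrib_left)
  finally show ?thesis by (simp add: 1 2)
qed

text \<open>The lowered contraction of the Cartan coefficients with \<open>y\<close> is half of \<open>S g\<close> plus the same
  antisymmetric term as in \<open>g_low_nonlin_conn\<close>.\<close>

lemma Gamma_contract:
  assumes W: "(x, y) \<in> W"
  shows "(\<Sum>k\<in>UNIV. y $ k * Gamma_coeff L r i k x y) = nonlin_conn L r i x y"
proof -
  let ?T = "\<lambda>l k. delta_x L i (g_low L l k) x y + delta_x L k (g_low L i l) x y - delta_x L l (g_low L i k) x y"
  have inner: "(\<Sum>k\<in>UNIV. y $ k * ?T l k) = 2 * (\<Sum>m\<in>UNIV. g_low L l m x y * nonlin_conn L m i x y)" for l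
  proof -
    have "(\<Sum>k\<in>UNIV. y $ k * ?T l k) = (\<Sum>k\<in>UNIV. y $ k * delta_x L i (g_low L l k) x y)
       + (\<Sum>k\<in>UNIV. y $ k * delta_x L k (g_low L i l) x y) - (\<Sum>k\<in>UNIV. y $ k * delta_x L l (g_low L i k) x y)"
      by (simp add: distrib_left right_diff_distrib sum_subtractf sum.distrib)
    moreover have "spray_field (g_low L i l) x y = spray_field (g_low L l i) x y"
      by (rule sp.cong[OF g_low_sym W])
    ultimately show ?thesis
      unfolding delta_g_low_contract[OF W] delta_x_contract[OF W] g_low_nonlin_conn[OF W] by simp
  qed
  have "(\<Sum>k\<in>UNIV. y $ k * Gamma_coeff L r i k x y) = 1/2 * (\<Sum>l\<in>UNIV. g_up L r l x y * (\<Sum>k\<in>UNIV. y $ k * ?T l k))"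
    unfolding Gamma_coeff_def sum_distrib_left by (subst sum.swap) (simp add: mult_ac)
  also have "\<dots> = (\<Sum>l\<in>UNIV. g_up L r l x y * (\<Sum>m\<in>UNIV. g_low L l m x y * nonlin_conn L m i x y))"
    unfolding inner sum_distrib_left by (intro sum.cong refl) simp
  also have "\<dots> = nonlin_conn L r i x y" by (rule raise_lowered[OF W])
  finally show ?thesis .
qed

text \<open>After contraction with \<open>y\<close> the Cartan derivative depends on the spray alone.\<close>

lemma nabla0_cov2_eq:
  assumes W: "(x, y) \<in> W"
  shows "nabla0_cov2 L T i j x y = spray_field (T i j) x y
    - (\<Sum>r\<in>UNIV. nonlin_conn L r i x y * T r j x y) - (\<Sum>r\<in>UNIV. nonlin_conn L r j x y * T i r x y)"
proof -
  have *: "(\<Sum>k\<in>UNIV. y $ k * (\<Sum>r\<in>UNIV. Gamma_coeff L r i k x y * t r))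
      = (\<Sum>r\<in>UNIV. nonlin_conn L r i x y * t r)" for i t
    unfolding Gamma_contract[OF W, symmetric] sum_distrib_left sum_distrib_right
    by (subst sum.swap) (simp add: mult.assoc)
  show ?thesis
    unfolding nabla0_cov2_def nabla_cov2_def right_diff_distrib sum_subtractf
      delta_x_contract[OF W] * by simp
qed

lemma smooth_berwald: "smooth_cfun W (berwald_curv L i j k l)"
  unfolding berwald_curv_def by (intro smooth_intros smooth_spray)

lemma smooth_E_curv: "smooth_cfun W (E_curv L i j)"
  unfolding E_curv_def by (intro smooth_intros smooth_berwald)

lemma euler_pdy_pdy_spray: "(x, y) \<in> W \<Longrightarrow> euler_field (pdy k (pdy j (spray L i))) x y = 0"
proof -
  have "euler_field (pdy j (spray L i)) x y = 1 * pdy j (spray L i) x y" if "(x, y) \<in> W" for x y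
    using euler_field_pdy[OF open_W smooth_spray euler_spray that] by simp
  from euler_field_pdy[OF open_W dy.smooth[OF smooth_spray] this]
  show "(x, y) \<in> W \<Longrightarrow> euler_field (pdy k (pdy j (spray L i))) x y = 0" by simp
qed

lemma euler_E_curv:
  assumes W: "(x, y) \<in> W" shows "euler_field (E_curv L i j) x y = - E_curv L i j x y"
proof -
  have "euler_field (berwald_curv L r i r j) x y = - berwald_curv L r i r j x y" for r
    using euler_field_pdy[OF open_W _ _ W, of "pdy r (pdy i (spray L r))" 0 j]
    by (simp add: berwald_curv_def euler_pdy_pdy_spray smooth_intros smooth_spray)
  then show ?thesis
    unfolding E_curv_def using W
    by (simp add: eu.cmult eu.sum smooth_berwald smooth_intros sum_negf del: times_divide_eq_left)
qed

text \<open>Fibre derivatives commute, so \<open>y\<^sup>r\<close> can be contracted with the outermost one. It then acts as the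
  Euler field on second fibre derivatives of the spray, which have degree 0.\<close>

lemma E_curv_contract:
  assumes W: "(x, y) \<in> W"
  shows "(\<Sum>r\<in>UNIV. y $ r * E_curv L r j x y) = 0" "(\<Sum>r\<in>UNIV. y $ r * E_curv L i r x y) = 0"
proof -
  have *: "(\<Sum>r\<in>UNIV. y $ r * (1/2 * (\<Sum>s\<in>UNIV. pdy r (f s) x y))) = 1/2 * (\<Sum>s\<in>UNIV. euler_field (f s) x y)"
    for f :: "'n \<Rightarrow> 'n cfun"
    unfolding euler_field_eq sum_distrib_left by (subst sum.swap) (simp add: mult_ac)
  show "(\<Sum>r\<in>UNIV. y $ r * E_curv L i r x y) = 0"
    unfolding E_curv_def berwald_curv_def * by (simp add: euler_pdy_pdy_spray[OF W])
  have "pdy j (pdy s (pdy r (spray L s))) x y = pdy r (pdy j (pdy s (spray L s))) x y" for r s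
  proof -
    have "pdy j (pdy s (pdy r (spray L s))) x y = pdy j (pdy r (pdy s (spray L s))) x y"
      by (rule dy.cong[OF _ W]) (rule comm(3)[OF smooth_spray])
    also have "\<dots> = pdy r (pdy j (pdy s (spray L s))) x y"
      by (rule comm(3)[OF dy.smooth[OF smooth_spray] W])
    finally show ?thesis .
  qed
  then show "(\<Sum>r\<in>UNIV. y $ r * E_curv L r j x y) = 0"
    unfolding E_curv_def berwald_curv_def by (simp only: *) (simp add: euler_pdy_pdy_spray[OF W])
qed

end

section \<open>Projective vector fields in one chart\<close>

text \<open>\<open>Z\<close> is the coordinate expression of a projective vector field. The function \<open>\<psi>\<close> is homogeneous, and its smoothness
  follows from the equation for the Lie derivative of the spray (\<open>smooth_psi\<close>).\<close>

locale projective_chart = finsler_chart U L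
  for U :: "(real^'n::finite) set" and L +
  fixes Z :: "real^'n \<Rightarrow> real^'n" and \<psi> :: "'n cfun"
  assumes smooth_Z: "smooth_on Z U"
    and lie_spray_eq: "(x, y) \<in> W \<Longrightarrow> lie_spray Z (spray L) i x y = \<psi> x y * y $ i"
    and homogeneous_psi: "(x, y) \<in> W \<Longrightarrow> a > 0 \<Longrightarrow> \<psi> x (a *\<^sub>R y) = a * \<psi> x y"
begin

lemma smooth_Z_component: "smooth_cfun W (\<lambda>x y. Z x $ i)"
  by (rule smooth_cfun_base[OF open_U smooth_Z open_W]) (simp add: W_def)

lemma smooth_dX: "smooth_cfun W (dX Z i j)"
  unfolding dX_def by (intro smooth_intros smooth_Z_component)

lemma pdy_dX: "pdy l (dX Z i j) x y = 0"
  unfolding dX_def pdx_def by (rule pdy_base)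

lemma pdy_pdx_dX: "pdy l (pdx k (dX Z i j)) x y = 0"
  unfolding dX_def pdx_def by (rule pdy_base)

lemma pdx_dX_sym: "(x, y) \<in> W \<Longrightarrow> pdx k (dX Z i j) x y = pdx j (dX Z i k) x y"
  unfolding dX_def by (rule comm(1)[OF smooth_Z_component])

lemma complete_lift_combination: "complete_lift Z =
    combination (case_sum (\<lambda>i x y. Z x $ i) (\<lambda>i x y. \<Sum>k\<in>UNIV. y $ k * dX Z i k x y)) pd"
  by (simp add: fun_eq_iff complete_lift_def combination_def sum_UNIV_Plus pd_def)

lemma smooth_lift_components:
  "smooth_cfun W (case_sum (\<lambda>i x y. Z x $ i) (\<lambda>i x y. \<Sum>k\<in>UNIV. y $ k * dX Z i k x y) \<alpha>)"
proof (cases \<alpha>)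
  case (Inl k)
  show ?thesis unfolding Inl sum.case by (rule smooth_Z_component)
next
  case (Inr k)
  show ?thesis unfolding Inr sum.case by (intro smooth_intros smooth_dX)
qed

sublocale lf: derivation W "complete_lift Z"
  unfolding complete_lift_combination
  by (intro derivation_combination derivation_pd open_W smooth_lift_components)

lemma smooth_lie_spray: "smooth_cfun W (lie_spray Z (spray L) i)"
  unfolding lie_spray_def by (intro smooth_intros smooth_dX smooth_spray lf.smooth)

lemma smooth_psi: "smooth_cfun W \<psi>"
proof (rule smooth_cfun_cong[OF open_W])
  \<comment> \<open>The inner product of \<open>\<psi> y\<close> with \<open>y\<close> recovers \<open>\<psi>\<close> from the smooth functions \<open>\<pounds>G\<^sup>i\<close>.\<close>
  have nz: "(\<Sum>i\<in>UNIV. y $ i * y $ i) \<noteq> 0" if "(x, y) \<in> W" for x y :: "real^'n"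
    using that inner_eq_zero_iff[of y] by (simp add: W_def inner_vec_def)
  show "smooth_cfun W (\<lambda>x y. (\<Sum>i\<in>UNIV. lie_spray Z (spray L) i x y * y $ i) / (\<Sum>i\<in>UNIV. y $ i * y $ i))"
    by (intro smooth_cfun_divide[OF open_W] smooth_intros smooth_lie_spray nz)
  show "(\<Sum>i\<in>UNIV. lie_spray Z (spray L) i x y * y $ i) / (\<Sum>i\<in>UNIV. y $ i * y $ i) = \<psi> x y"
    if "(x, y) \<in> W" for x y
    using nz[OF that] by (simp add: lie_spray_eq[OF that] mult.assoc sum_distrib_left[symmetric])
qed

lemma euler_psi: "(x, y) \<in> W \<Longrightarrow> euler_field \<psi> x y = \<psi> x y"
  using euler_field_homogeneous[OF smooth_psi, of x y 1] homogeneous_psi by simp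

text \<open>The extra term is the one by which the Lie derivative of a covariant index differs from \<open>X^\<close>. Hence
  fibre derivatives commute with Lie derivatives.\<close>

lemma pdy_complete_lift:
  assumes f: "smooth_cfun W f" and W: "(x, y) \<in> W"
  shows "pdy i (complete_lift Z f) x y
    = complete_lift Z (pdy i f) x y + (\<Sum>j\<in>UNIV. dX Z j i x y * pdy j f x y)"
proof -
  let ?b = "\<lambda>j x y. \<Sum>k\<in>UNIV. y $ k * dX Z j k x y"
  have b: "pdy i (?b j) x y = dX Z j i x y" for j
  proof -
    have "pdy i (?b j) x y = (\<Sum>k\<in>UNIV. pdy i (\<lambda>x y. y $ k) x y * dX Z j k x y)
        + (\<Sum>k\<in>UNIV. y $ k * pdy i (dX Z j k) x y)"
      by (intro dy.sum_mult smooth_intros smooth_dX W)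
    then show ?thesis by (simp add: pdy_coord sum_UNIV_delta pdy_dX)
  qed
  have "pdy i (complete_lift Z f) x y = pdy i (\<lambda>x y. \<Sum>j\<in>UNIV. Z x $ j * pdx j f x y) x y
      + pdy i (\<lambda>x y. \<Sum>j\<in>UNIV. ?b j x y * pdy j f x y) x y"
    unfolding complete_lift_def by (intro dy.add smooth_intros smooth_dX smooth_Z_component f W)
  also have "pdy i (\<lambda>x y. \<Sum>j\<in>UNIV. Z x $ j * pdx j f x y) x y
      = (\<Sum>j\<in>UNIV. pdy i (\<lambda>x y. Z x $ j) x y * pdx j f x y) + (\<Sum>j\<in>UNIV. Z x $ j * pdy i (pdx j f) x y)"
    by (intro dy.sum_mult smooth_intros smooth_Z_component f W)
  also have "pdy i (\<lambda>x y. \<Sum>j\<in>UNIV. ?b j x y * pdy j f x y) x y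
      = (\<Sum>j\<in>UNIV. pdy i (?b j) x y * pdy j f x y) + (\<Sum>j\<in>UNIV. ?b j x y * pdy i (pdy j f) x y)"
    by (intro dy.sum_mult smooth_intros smooth_dX f W)
  finally show ?thesis
    unfolding b pdy_base complete_lift_def
    by (simp add: comm(2)[OF f W] comm(3)[OF f W, of i])
qed

text \<open>The bracket of \<open>X^\<close> with the spray field is \<open>-2 (\<pounds>G\<^sup>k) \<partial>/\<partial>y\<^sup>k = -2 \<psi> C\<close>. Its base components vanish
  because the fibre components of the complete lift are \<open>y\<^sup>k \<partial>X\<^sup>i/\<partial>x\<^sup>k\<close>.\<close>

lemma complete_lift_spray_field:
  assumes f: "smooth_cfun W f" and W: "(x, y) \<in> W"
  shows "complete_lift Z (spray_field f) x y
    = spray_field (complete_lift Z f) x y - 2 * \<psi> x y * euler_field f x y"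
proof -
  let ?a = "case_sum (\<lambda>i x y. Z x $ i) (\<lambda>i x y. \<Sum>k\<in>UNIV. y $ k * dX Z i k x y)"
  let ?s = "case_sum (\<lambda>k x y. y $ k) (\<lambda>k x y. - 2 * spray L k x y)"
  have C: "complete_lift Z (spray_field f) x y - spray_field (complete_lift Z f) x y
      = (\<Sum>\<alpha>\<in>UNIV. (complete_lift Z (?s \<alpha>) x y - spray_field (?a \<alpha>) x y) * pd \<alpha> f x y)"
    unfolding complete_lift_combination spray_field_def
    by (rule combination_commutator[OF open_W derivation_pd[OF open_W] pd_commute[OF open_W]
          smooth_lift_components smooth_spray_field_components f W])
  have base: "complete_lift Z (?s (Inl k)) x y - spray_field (?a (Inl k)) x y = 0" for k
    unfolding sum.case spray_field_eq
    by (simp add: complete_lift_def pdx_coord pdy_coord pdy_base sum_UNIV_delta dX_def)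
  have fibre: "complete_lift Z (?s (Inr k)) x y - spray_field (?a (Inr k)) x y = - 2 * \<psi> x y * y $ k" for k
  proof -
    have 1: "spray_field (\<lambda>x y. y $ m) x y = - 2 * spray L m x y" for m
      by (simp add: spray_field_eq pdx_coord pdy_coord sum_UNIV_delta)
    have 2: "spray_field (dX Z k m) x y = (\<Sum>j\<in>UNIV. y $ j * pdx j (dX Z k m) x y)" for m
      by (simp add: spray_field_eq pdy_dX)
    have 3: "spray_field (?a (Inr k)) x y = (\<Sum>m\<in>UNIV. spray_field (\<lambda>x y. y $ m) x y * dX Z k m x y)
        + (\<Sum>m\<in>UNIV. y $ m * spray_field (dX Z k m) x y)"
      unfolding sum.case by (intro sp.sum_mult smooth_intros smooth_dX W)
    have 4: "(\<Sum>m\<in>UNIV. y $ m * spray_field (dX Z k m) x y)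
        = (\<Sum>j\<in>UNIV. \<Sum>m\<in>UNIV. y $ j * y $ m * pdx j (dX Z k m) x y)"
      unfolding 2 sum_distrib_left by (subst sum.swap) (simp add: mult_ac)
    have 5: "complete_lift Z (?s (Inr k)) x y = - 2 * complete_lift Z (spray L k) x y"
      unfolding sum.case by (rule lf.cmult[OF smooth_spray W])
    have 6: "(\<Sum>m\<in>UNIV. spray_field (\<lambda>x y. y $ m) x y * dX Z k m x y)
        = - 2 * (\<Sum>m\<in>UNIV. spray L m x y * dX Z k m x y)"
      unfolding 1 sum_distrib_left by (simp add: mult_ac)
    show ?thesis
      using lie_spray_eq[OF W, of k] unfolding 3 4 5 6 lie_spray_def by simp
  qed
  have "(\<Sum>\<alpha>\<in>UNIV. (complete_lift Z (?s \<alpha>) x y - spray_field (?a \<alpha>) x y) * pd \<alpha> f x y)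
      = - 2 * \<psi> x y * euler_field f x y"
    unfolding sum_UNIV_Plus base fibre
    by (simp add: pd_def euler_field_eq sum_distrib_left mult.assoc)
  with C show ?thesis by simp
qed

text \<open>The second derivatives of the vector field are symmetric, so the quadratic form in \<open>y\<close> at the end
  of \<open>\<pounds>G\<^sup>i\<close> contributes twice.\<close>

lemma pdy_lie_spray:
  assumes W: "(x, y) \<in> W"
  shows "pdy j (lie_spray Z (spray L) i) x y = complete_lift Z (nonlin_conn L i j) x y
    - (\<Sum>r\<in>UNIV. nonlin_conn L r j x y * dX Z i r x y)
    + (\<Sum>r\<in>UNIV. nonlin_conn L i r x y * dX Z r j x y)
    + (\<Sum>k\<in>UNIV. y $ k * pdx k (dX Z i j) x y)"
proof -
  let ?q = "\<lambda>x y. \<Sum>a\<in>UNIV. y $ a * (\<Sum>k\<in>UNIV. y $ k * pdx a (dX Z i k) x y)"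
  have inner: "pdy j (\<lambda>x y. \<Sum>k\<in>UNIV. y $ k * pdx a (dX Z i k) x y) x y = pdx a (dX Z i j) x y" for a
  proof -
    have "pdy j (\<lambda>x y. \<Sum>k\<in>UNIV. y $ k * pdx a (dX Z i k) x y) x y
      = (\<Sum>k\<in>UNIV. pdy j (\<lambda>x y. y $ k) x y * pdx a (dX Z i k) x y)
        + (\<Sum>k\<in>UNIV. y $ k * pdy j (pdx a (dX Z i k)) x y)"
      by (intro dy.sum_mult smooth_intros smooth_dX W)
    then show ?thesis by (simp add: pdy_coord sum_UNIV_delta pdy_pdx_dX)
  qed
  have q: "pdy j ?q x y = 2 * (\<Sum>k\<in>UNIV. y $ k * pdx k (dX Z i j) x y)"
  proof -
    have "pdy j ?q x y = (\<Sum>a\<in>UNIV. pdy j (\<lambda>x y. y $ a) x y * (\<Sum>k\<in>UNIV. y $ k * pdx a (dX Z i k) x y))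
        + (\<Sum>a\<in>UNIV. y $ a * pdy j (\<lambda>x y. \<Sum>k\<in>UNIV. y $ k * pdx a (dX Z i k) x y) x y)"
      by (intro dy.sum_mult smooth_intros smooth_dX W)
    then show ?thesis
      unfolding inner pdy_coord sum_UNIV_delta by (simp add: pdx_dX_sym[OF W, of j])
  qed
  have "lie_spray Z (spray L) i = (\<lambda>x y. complete_lift Z (spray L i) x y
      - (\<Sum>r\<in>UNIV. spray L r x y * dX Z i r x y) + 1/2 * ?q x y)"
    by (simp add: lie_spray_def fun_eq_iff sum_distrib_left mult.assoc)
  then have "pdy j (lie_spray Z (spray L) i) x y = pdy j (\<lambda>x y. complete_lift Z (spray L i) x y
      - (\<Sum>r\<in>UNIV. spray L r x y * dX Z i r x y) + 1/2 * ?q x y) x y" by simp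
  also have "\<dots> = pdy j (\<lambda>x y. complete_lift Z (spray L i) x y
      - (\<Sum>r\<in>UNIV. spray L r x y * dX Z i r x y)) x y + pdy j (\<lambda>x y. 1/2 * ?q x y) x y"
    by (intro dy.add smooth_intros smooth_dX smooth_spray lf.smooth W)
  also have "pdy j (\<lambda>x y. 1/2 * ?q x y) x y = 1/2 * pdy j ?q x y"
    by (intro dy.cmult smooth_intros smooth_dX W)
  also have "pdy j (\<lambda>x y. complete_lift Z (spray L i) x y - (\<Sum>r\<in>UNIV. spray L r x y * dX Z i r x y)) x y
      = pdy j (complete_lift Z (spray L i)) x y - pdy j (\<lambda>x y. \<Sum>r\<in>UNIV. spray L r x y * dX Z i r x y) x y"
    by (intro dy.diff smooth_intros smooth_dX smooth_spray lf.smooth W)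
  also have "pdy j (\<lambda>x y. \<Sum>r\<in>UNIV. spray L r x y * dX Z i r x y) x y
      = (\<Sum>r\<in>UNIV. pdy j (spray L r) x y * dX Z i r x y) + (\<Sum>r\<in>UNIV. spray L r x y * pdy j (dX Z i r) x y)"
    by (intro dy.sum_mult smooth_dX smooth_spray W)
  also have "pdy j (complete_lift Z (spray L i)) x y
      = complete_lift Z (pdy j (spray L i)) x y + (\<Sum>r\<in>UNIV. dX Z r j x y * pdy r (spray L i) x y)"
    by (rule pdy_complete_lift[OF smooth_spray W])
  finally show ?thesis
    unfolding q by (simp add: pdy_dX nonlin_conn_def mult.commute)
qed

text \<open>The Lie derivative of \<open>N\<^sup>i\<^sub>j\<close>, the fibre derivative of \<open>\<pounds>G\<^sup>i = \<psi> y\<^sup>i\<close>, solved for \<open>X^ (N\<^sup>i\<^sub>j)\<close>.\<close>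

lemma lie_nonlin_conn:
  assumes W: "(x, y) \<in> W"
  shows "complete_lift Z (nonlin_conn L i j) x y = pdy j \<psi> x y * y $ i + \<psi> x y * (if i = j then 1 else 0)
    + (\<Sum>r\<in>UNIV. nonlin_conn L r j x y * dX Z i r x y)
    - (\<Sum>r\<in>UNIV. nonlin_conn L i r x y * dX Z r j x y)
    - (\<Sum>k\<in>UNIV. y $ k * pdx k (dX Z i j) x y)"
proof -
  have "pdy j (lie_spray Z (spray L) i) x y = pdy j (\<lambda>x y. \<psi> x y * y $ i) x y"
    by (rule dy.cong[OF lie_spray_eq W])
  also have "\<dots> = pdy j \<psi> x y * y $ i + \<psi> x y * pdy j (\<lambda>x y. y $ i) x y"
    by (intro dy.mult smooth_psi smooth_intros W)
  finally show ?thesis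
    using pdy_lie_spray[OF W, of j i] by (simp add: pdy_coord)
qed

text \<open>The mean Cartan torsion is the fibre derivative of \<open>f = ln (sqrt (det g))\<close>, so its Lie derivative is
  the fibre derivative of \<open>X^ f\<close>.\<close>

lemma lie_mean_cartan:
  assumes W: "(x, y) \<in> W"
  shows "pdy i (half_trace (g_up L) (g_low L) (complete_lift Z)) x y = lie_cov1 Z (mean_cartan L) i x y"
proof -
  have I: "mean_cartan L i = half_trace (g_up L) (g_low L) (pdy i)" for i
    by (simp add: mean_cartan_def half_trace_def)
  have "pdy i (half_trace (g_up L) (g_low L) (complete_lift Z)) x y
      - complete_lift Z (half_trace (g_up L) (g_low L) (pdy i)) x y
    = half_trace (g_up L) (g_low L) (\<lambda>f x y. pdy i (complete_lift Z f) x y - complete_lift Z (pdy i f) x y) x y"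
    by (rule half_trace_commutator[OF dy.derivation_axioms lf.derivation_axioms smooth_g_low smooth_g_up
        g_up_sym g_low_g_up g_up_g_low W])
  also have "\<dots> = 1/2 * (\<Sum>j\<in>UNIV. \<Sum>k\<in>UNIV. \<Sum>r\<in>UNIV. g_up L j k x y * (dX Z r i x y * pdy r (g_low L j k) x y))"
    unfolding half_trace_def by (simp add: pdy_complete_lift smooth_g_low W sum_distrib_left)
  also have "(\<Sum>j\<in>UNIV. \<Sum>k\<in>UNIV. \<Sum>r\<in>UNIV. g_up L j k x y * (dX Z r i x y * pdy r (g_low L j k) x y))
      = (\<Sum>j\<in>UNIV. \<Sum>r\<in>UNIV. \<Sum>k\<in>UNIV. g_up L j k x y * (dX Z r i x y * pdy r (g_low L j k) x y))"
    by (rule sum.cong[OF refl]) (rule sum.swap)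
  also have "\<dots> = (\<Sum>r\<in>UNIV. \<Sum>j\<in>UNIV. \<Sum>k\<in>UNIV. g_up L j k x y * (dX Z r i x y * pdy r (g_low L j k) x y))"
    by (rule sum.swap)
  also have "1/2 * \<dots> = (\<Sum>r\<in>UNIV. mean_cartan L r x y * dX Z r i x y)"
    unfolding mean_cartan_def sum_distrib_left sum_distrib_right by (intro sum.cong refl) simp
  finally show ?thesis unfolding lie_cov1_def I by simp
qed

end

locale I_projective_chart = projective_chart U L Z \<psi>
  for U :: "(real^'n::finite) set" and L Z \<psi> +
  assumes lie_I: "(x, y) \<in> W \<Longrightarrow> lie_cov1 Z (mean_cartan L) i x y = 0"
begin

text \<open>The rate of change of the density \<open>sqrt (det g)\<close> under the flow of the vector field, that is half
  the trace of the Lie derivative of \<open>g\<close>.\<close>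

definition volume_rate :: "'n cfun" where
  "volume_rate = (\<lambda>x y. half_trace (g_up L) (g_low L) (complete_lift Z) x y + (\<Sum>r\<in>UNIV. dX Z r r x y))"

lemma smooth_volume_rate: "smooth_cfun W volume_rate"
  unfolding volume_rate_def
  by (intro smooth_intros smooth_dX lf.smooth_half_trace smooth_g_low smooth_g_up)

lemma pdy_volume_rate: 
  assumes W: "(x, y) \<in> W" shows "pdy i volume_rate x y = 0"
proof -
  have "pdy i volume_rate x y = pdy i (half_trace (g_up L) (g_low L) (complete_lift Z)) x y
      + pdy i (\<lambda>x y. \<Sum>r\<in>UNIV. dX Z r r x y) x y"
    unfolding volume_rate_def
    by (intro dy.add smooth_intros smooth_dX lf.smooth_half_trace smooth_g_low smooth_g_up W)
  also have "pdy i (\<lambda>x y. \<Sum>r\<in>UNIV. dX Z r r x y) x y = (\<Sum>r\<in>UNIV. pdy i (dX Z r r) x y)"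
    by (intro dy.sum smooth_dX W)
  finally show ?thesis by (simp add: lie_mean_cartan[OF W] lie_I[OF W] pdy_dX)
qed

text \<open>The rate at which \<open>N\<^sup>i\<^sub>i = S f\<close> changes along \<open>X^\<close>, for \<open>f = ln (sqrt (det g))\<close>, is computed in two
  ways. By the bracket with the spray it is \<open>X^ (S f) = S (X^ f) - 2 \<psi> C f\<close>, where \<open>C f = 0\<close> by
  homogeneity and \<open>S (X^ f)\<close> has base derivatives only because \<open>\<pounds>I = 0\<close>. By the trace of
  \<open>lie_nonlin_conn\<close> it is \<open>(n + 1) \<psi>\<close> minus the term with the divergence of the vector field.\<close>

lemma psi_eq:
  assumes W: "(x, y) \<in> W"
  shows "(real CARD('n) + 1) * \<psi> x y = (\<Sum>k\<in>UNIV. y $ k * pdx k volume_rate x y)"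
proof -
  let ?phi = "half_trace (g_up L) (g_low L) (complete_lift Z)"
  have trace: "(\<Sum>i\<in>UNIV. complete_lift Z (nonlin_conn L i i) x y)
      = (real CARD('n) + 1) * \<psi> x y - (\<Sum>k\<in>UNIV. y $ k * pdx k (\<lambda>x y. \<Sum>r\<in>UNIV. dX Z r r x y) x y)"
  proof -
    have "(\<Sum>i\<in>UNIV. \<Sum>r\<in>UNIV. nonlin_conn L r i x y * dX Z i r x y)
        = (\<Sum>i\<in>UNIV. \<Sum>r\<in>UNIV. nonlin_conn L i r x y * dX Z r i x y)"
      by (rule sum.swap)
    moreover have "(\<Sum>i\<in>UNIV. pdy i \<psi> x y * y $ i) = \<psi> x y"
      using euler_psi[OF W] by (simp add: euler_field_eq mult.commute)
    moreover have "(\<Sum>i\<in>UNIV. \<Sum>k\<in>UNIV. y $ k * pdx k (dX Z i i) x y)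
        = (\<Sum>k\<in>UNIV. y $ k * pdx k (\<lambda>x y. \<Sum>r\<in>UNIV. dX Z r r x y) x y)"
      by (subst sum.swap) (simp add: dx.sum smooth_dX W sum_distrib_left)
    ultimately show ?thesis
      unfolding lie_nonlin_conn[OF W] sum_subtractf sum.distrib by (simp add: algebra_simps)
  qed
  have "(\<Sum>i\<in>UNIV. complete_lift Z (nonlin_conn L i i) x y) = complete_lift Z (\<lambda>x y. \<Sum>i\<in>UNIV. nonlin_conn L i i x y) x y"
    by (simp add: lf.sum smooth_nonlin_conn W)
  also have "\<dots> = complete_lift Z (half_trace (g_up L) (g_low L) spray_field) x y"
    by (rule lf.cong[OF nonlin_conn_trace W])
  also have "\<dots> = spray_field ?phi x y"
  proof -
    have "complete_lift Z (half_trace (g_up L) (g_low L) spray_field) x y - spray_field ?phi x y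
        = half_trace (g_up L) (g_low L) (\<lambda>f x y. complete_lift Z (spray_field f) x y - spray_field (complete_lift Z f) x y) x y"
      by (rule half_trace_commutator[OF lf.derivation_axioms sp.derivation_axioms smooth_g_low smooth_g_up
          g_up_sym g_low_g_up g_up_g_low W])
    also have "\<dots> = 0"
      by (simp add: half_trace_def complete_lift_spray_field smooth_g_low W euler_g_low)
    finally show ?thesis by simp
  qed
  also have "\<dots> = (\<Sum>k\<in>UNIV. y $ k * pdx k ?phi x y)"
    by (simp add: spray_field_eq lie_mean_cartan[OF W] lie_I[OF W])
  finally have "(real CARD('n) + 1) * \<psi> x y = (\<Sum>k\<in>UNIV. y $ k * pdx k ?phi x y)
      + (\<Sum>k\<in>UNIV. y $ k * pdx k (\<lambda>x y. \<Sum>r\<in>UNIV. dX Z r r x y) x y)"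
    using trace by simp
  also have "\<dots> = (\<Sum>k\<in>UNIV. y $ k * pdx k volume_rate x y)"
  proof -
    have "pdx k volume_rate x y = pdx k ?phi x y + pdx k (\<lambda>x y. \<Sum>r\<in>UNIV. dX Z r r x y) x y" for k
      unfolding volume_rate_def
      by (intro dx.add smooth_intros smooth_dX lf.smooth_half_trace smooth_g_low smooth_g_up W)
    then show ?thesis by (simp add: distrib_left sum.distrib)
  qed
  finally show ?thesis .
qed

text \<open>\<open>\<psi>\<close> is linear in \<open>y\<close> near each point, since the coefficients \<open>\<partial>(volume_rate)/\<partial>x\<^sup>k\<close> in \<open>psi_eq\<close> have
  vanishing fibre derivatives.\<close>

lemma pdy_pdy_psi:
  assumes W: "(x, y) \<in> W"
  shows "pdy i (pdy j \<psi>) x y = 0"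
proof -
  have 1: "(real CARD('n) + 1) * pdy j \<psi> x y = pdx j volume_rate x y" if W: "(x, y) \<in> W" for x y j
  proof -
    have 0: "pdy j (pdx k volume_rate) x y = 0" for k
    proof -
      have "pdx k (pdy j volume_rate) x y = pdx k (\<lambda>x y. 0) x y"
        by (rule dx.cong[OF pdy_volume_rate W])
      then show ?thesis by (simp add: comm(2)[OF smooth_volume_rate W] dx.const[OF W])
    qed
    have "(real CARD('n) + 1) * pdy j \<psi> x y = pdy j (\<lambda>x y. (real CARD('n) + 1) * \<psi> x y) x y"
      by (rule dy.cmult[OF smooth_psi W, symmetric])
    also have "\<dots> = pdy j (\<lambda>x y. \<Sum>k\<in>UNIV. y $ k * pdx k volume_rate x y) x y"
      by (rule dy.cong[OF psi_eq W])
    also have "\<dots> = (\<Sum>k\<in>UNIV. pdy j (\<lambda>x y. y $ k) x y * pdx k volume_rate x y)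
        + (\<Sum>k\<in>UNIV. y $ k * pdy j (pdx k volume_rate) x y)"
      by (intro dy.sum_mult smooth_intros smooth_volume_rate W)
    finally show ?thesis by (simp add: 0 pdy_coord sum_UNIV_delta)
  qed
  have "(real CARD('n) + 1) * pdy i (pdy j \<psi>) x y = pdy i (\<lambda>x y. (real CARD('n) + 1) * pdy j \<psi> x y) x y"
    by (rule dy.cmult[OF dy.smooth[OF smooth_psi] W, symmetric])
  also have "\<dots> = pdy i (pdx j volume_rate) x y"
    by (rule dy.cong[OF 1 W])
  also have "\<dots> = pdx j (pdy i volume_rate) x y"
    by (rule comm(2)[OF smooth_volume_rate W, symmetric])
  also have "\<dots> = pdx j (\<lambda>x y. 0) x y"
    by (rule dx.cong[OF pdy_volume_rate W])
  finally show ?thesis by (simp add: dx.const[OF W])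
qed

lemma pdy_sum_dX:
  assumes "\<And>r. smooth_cfun W (f r)" and W: "(x, y) \<in> W"
  shows "pdy k (\<lambda>x y. \<Sum>r\<in>UNIV. f r x y * dX Z (p r) (q r) x y) x y
    = (\<Sum>r\<in>UNIV. pdy k (f r) x y * dX Z (p r) (q r) x y)"
proof -
  have "pdy k (\<lambda>x y. \<Sum>r\<in>UNIV. f r x y * dX Z (p r) (q r) x y) x y
    = (\<Sum>r\<in>UNIV. pdy k (f r) x y * dX Z (p r) (q r) x y) + (\<Sum>r\<in>UNIV. f r x y * pdy k (dX Z (p r) (q r)) x y)"
    by (intro dy.sum_mult assms smooth_dX)
  then show ?thesis by (simp add: pdy_dX)
qed

text \<open>The Lie derivative of \<open>\<partial>N\<^sup>i\<^sub>j/\<partial>y\<^sup>k\<close>, which are connection coefficients: the inhomogeneous term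
  \<open>\<partial>\<^sup>2X\<^sup>i/\<partial>x\<^sup>j\<partial>x\<^sup>k\<close> disappears only with the next fibre derivative.\<close>

lemma pdy_pdy_lie_spray:
  assumes W: "(x, y) \<in> W"
  shows "pdy k (pdy j (lie_spray Z (spray L) i)) x y = complete_lift Z (pdy k (nonlin_conn L i j)) x y
    - (\<Sum>r\<in>UNIV. pdy k (nonlin_conn L r j) x y * dX Z i r x y)
    + (\<Sum>r\<in>UNIV. pdy k (nonlin_conn L i r) x y * dX Z r j x y)
    + (\<Sum>r\<in>UNIV. pdy r (nonlin_conn L i j) x y * dX Z r k x y)
    + pdx k (dX Z i j) x y"
proof -
  let ?A = "complete_lift Z (nonlin_conn L i j)"
  let ?B = "\<lambda>x y. \<Sum>r\<in>UNIV. nonlin_conn L r j x y * dX Z i r x y"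
  let ?C = "\<lambda>x y. \<Sum>r\<in>UNIV. nonlin_conn L i r x y * dX Z r j x y"
  let ?D = "\<lambda>x y. \<Sum>a\<in>UNIV. y $ a * pdx a (dX Z i j) x y"
  note sm = smooth_intros smooth_dX smooth_nonlin_conn lf.smooth
  have "pdy k (pdy j (lie_spray Z (spray L) i)) x y = pdy k (\<lambda>x y. ?A x y - ?B x y + ?C x y + ?D x y) x y"
    by (rule dy.cong[OF pdy_lie_spray W])
  also have "\<dots> = pdy k (\<lambda>x y. ?A x y - ?B x y + ?C x y) x y + pdy k ?D x y"
    by (intro dy.add sm W)
  also have "pdy k (\<lambda>x y. ?A x y - ?B x y + ?C x y) x y = pdy k (\<lambda>x y. ?A x y - ?B x y) x y + pdy k ?C x y"
    by (intro dy.add sm W)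
  also have "pdy k (\<lambda>x y. ?A x y - ?B x y) x y = pdy k ?A x y - pdy k ?B x y"
    by (intro dy.diff sm W)
  also have "pdy k ?D x y = (\<Sum>a\<in>UNIV. pdy k (\<lambda>x y. y $ a) x y * pdx a (dX Z i j) x y)
      + (\<Sum>a\<in>UNIV. y $ a * pdy k (pdx a (dX Z i j)) x y)"
    by (intro dy.sum_mult sm W)
  finally show ?thesis
    unfolding pdy_complete_lift[OF smooth_nonlin_conn W] pdy_sum_dX[OF smooth_nonlin_conn W]
    by (simp add: pdy_coord sum_UNIV_delta pdy_pdx_dX mult.commute)
qed

lemma pdy_pdy_pdy_lie_spray:
  assumes W: "(x, y) \<in> W"
  shows "pdy l (pdy k (pdy j (lie_spray Z (spray L) i))) x y = lie_con1_cov3 Z (berwald_curv L) i j k l x y"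
proof -
  let ?A = "complete_lift Z (pdy k (nonlin_conn L i j))"
  let ?B = "\<lambda>x y. \<Sum>r\<in>UNIV. pdy k (nonlin_conn L r j) x y * dX Z i r x y"
  let ?C = "\<lambda>x y. \<Sum>r\<in>UNIV. pdy k (nonlin_conn L i r) x y * dX Z r j x y"
  let ?D = "\<lambda>x y. \<Sum>r\<in>UNIV. pdy r (nonlin_conn L i j) x y * dX Z r k x y"
  note sm = smooth_intros smooth_dX smooth_nonlin_conn lf.smooth
  have "pdy l (pdy k (pdy j (lie_spray Z (spray L) i))) x y
      = pdy l (\<lambda>x y. ?A x y - ?B x y + ?C x y + ?D x y + pdx k (dX Z i j) x y) x y"
    by (rule dy.cong[OF pdy_pdy_lie_spray W])
  also have "\<dots> = pdy l (\<lambda>x y. ?A x y - ?B x y + ?C x y + ?D x y) x y + pdy l (pdx k (dX Z i j)) x y"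
    by (intro dy.add sm W)
  also have "pdy l (\<lambda>x y. ?A x y - ?B x y + ?C x y + ?D x y) x y
      = pdy l (\<lambda>x y. ?A x y - ?B x y + ?C x y) x y + pdy l ?D x y"
    by (intro dy.add sm W)
  also have "pdy l (\<lambda>x y. ?A x y - ?B x y + ?C x y) x y = pdy l (\<lambda>x y. ?A x y - ?B x y) x y + pdy l ?C x y"
    by (intro dy.add sm W)
  also have "pdy l (\<lambda>x y. ?A x y - ?B x y) x y = pdy l ?A x y - pdy l ?B x y"
    by (intro dy.diff sm W)
  finally show ?thesis
    unfolding pdy_complete_lift[OF dy.smooth[OF smooth_nonlin_conn] W] pdy_sum_dX[OF dy.smooth[OF smooth_nonlin_conn] W]
    by (simp add: pdy_pdx_dX lie_con1_cov3_def berwald_curv_def nonlin_conn_def mult.commute)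
qed

text \<open>Every term in the third fibre derivative of \<open>\<psi> y\<^sup>i\<close> contains a derivative of \<open>\<psi>\<close> of order at
  least two.\<close>

lemma lie_B:
  assumes W: "(x, y) \<in> W"
  shows "lie_con1_cov3 Z (berwald_curv L) i j k l x y = 0"
proof -
  let ?\<delta> = "\<lambda>i j. if i = j then 1 else (0 :: real)"
  have 1: "pdy j (lie_spray Z (spray L) i) x y = pdy j \<psi> x y * y $ i + \<psi> x y * ?\<delta> i j"
    if W: "(x, y) \<in> W" for x y j
  proof -
    have "pdy j (lie_spray Z (spray L) i) x y = pdy j (\<lambda>x y. \<psi> x y * y $ i) x y"
      by (rule dy.cong[OF lie_spray_eq W])
    also have "\<dots> = pdy j \<psi> x y * y $ i + \<psi> x y * pdy j (\<lambda>x y. y $ i) x y"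
      by (intro dy.mult smooth_psi smooth_intros W)
    finally show ?thesis by (simp add: pdy_coord)
  qed
  have 2: "pdy k (pdy j (lie_spray Z (spray L) i)) x y = ?\<delta> i k * pdy j \<psi> x y + ?\<delta> i j * pdy k \<psi> x y"
    if W: "(x, y) \<in> W" for x y j k
  proof -
    have "pdy k (pdy j (lie_spray Z (spray L) i)) x y
        = pdy k (\<lambda>x y. pdy j \<psi> x y * y $ i + \<psi> x y * ?\<delta> i j) x y"
      by (rule dy.cong[OF 1 W])
    also have "\<dots> = pdy k (\<lambda>x y. pdy j \<psi> x y * y $ i) x y + pdy k (\<lambda>x y. \<psi> x y * ?\<delta> i j) x y"
      by (intro dy.add smooth_psi smooth_intros W)
    also have "pdy k (\<lambda>x y. pdy j \<psi> x y * y $ i) x y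
        = pdy k (pdy j \<psi>) x y * y $ i + pdy j \<psi> x y * pdy k (\<lambda>x y. y $ i) x y"
      by (intro dy.mult smooth_psi smooth_intros W)
    also have "pdy k (\<lambda>x y. \<psi> x y * ?\<delta> i j) x y
        = pdy k \<psi> x y * ?\<delta> i j + \<psi> x y * pdy k (\<lambda>x y. ?\<delta> i j) x y"
      by (intro dy.mult smooth_psi smooth_intros W)
    finally show ?thesis by (simp only: pdy_pdy_psi[OF W] pdy_coord dy.const[OF W]) simp
  qed
  have "lie_con1_cov3 Z (berwald_curv L) i j k l x y = pdy l (pdy k (pdy j (lie_spray Z (spray L) i))) x y"
    by (rule pdy_pdy_pdy_lie_spray[OF W, symmetric])
  also have "\<dots> = pdy l (\<lambda>x y. ?\<delta> i k * pdy j \<psi> x y + ?\<delta> i j * pdy k \<psi> x y) x y"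
    by (rule dy.cong[OF 2 W])
  also have "\<dots> = pdy l (\<lambda>x y. ?\<delta> i k * pdy j \<psi> x y) x y + pdy l (\<lambda>x y. ?\<delta> i j * pdy k \<psi> x y) x y"
    by (intro dy.add smooth_psi smooth_intros W)
  also have "\<dots> = 0"
    by (simp only: dy.cmult[OF dy.smooth[OF smooth_psi] W] pdy_pdy_psi[OF W])
  finally show ?thesis .
qed

text \<open>The Lie derivative commutes with the contraction \<open>E\<^sub>i\<^sub>j = B\<^sup>r\<^sub>i\<^sub>r\<^sub>j / 2\<close>.\<close>

lemma lie_E:
  assumes W: "(x, y) \<in> W"
  shows "lie_cov2 Z (E_curv L) i j x y = 0"
proof -
  have "complete_lift Z (berwald_curv L r i r j) x y = 
    (\<Sum>s\<in>UNIV. berwald_curv L s i r j x y * dX Z r s x y)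
     - (\<Sum>s\<in>UNIV. berwald_curv L r s r j x y * dX Z s i x y)
     - (\<Sum>s\<in>UNIV. berwald_curv L r i s j x y * dX Z s r x y)
     - (\<Sum>s\<in>UNIV. berwald_curv L r i r s x y * dX Z s j x y)" for r
    using lie_B[OF W, of r i r j] by (simp add: lie_con1_cov3_def)
  moreover have "complete_lift Z (E_curv L i j) x y = 1/2 * (\<Sum>r\<in>UNIV. complete_lift Z (berwald_curv L r i r j) x y)"
  proof -
    have "complete_lift Z (E_curv L i j) x y = 1/2 * complete_lift Z (\<lambda>x y. \<Sum>r\<in>UNIV. berwald_curv L r i r j x y) x y"
      unfolding E_curv_def by (intro lf.cmult smooth_intros smooth_berwald W)
    also have "complete_lift Z (\<lambda>x y. \<Sum>r\<in>UNIV. berwald_curv L r i r j x y) x y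
      = (\<Sum>r\<in>UNIV. complete_lift Z (berwald_curv L r i r j) x y)"
      by (intro lf.sum smooth_berwald W)
    finally show ?thesis .
  qed
  moreover have "(\<Sum>r\<in>UNIV. \<Sum>s\<in>UNIV. berwald_curv L s i r j x y * dX Z r s x y)
      = (\<Sum>r\<in>UNIV. \<Sum>s\<in>UNIV. berwald_curv L r i s j x y * dX Z s r x y)"
    by (rule sum.swap)
  ultimately have 1: "complete_lift Z (E_curv L i j) x y
      = - 1/2 * (\<Sum>r\<in>UNIV. \<Sum>s\<in>UNIV. berwald_curv L r s r j x y * dX Z s i x y)
        - 1/2 * (\<Sum>r\<in>UNIV. \<Sum>s\<in>UNIV. berwald_curv L r i r s x y * dX Z s j x y)"
    by (simp add: sum_subtractf)
  have 2: "(\<Sum>s\<in>UNIV. E_curv L s j x y * dX Z s i x y)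
      = 1/2 * (\<Sum>r\<in>UNIV. \<Sum>s\<in>UNIV. berwald_curv L r s r j x y * dX Z s i x y)"
    unfolding E_curv_def sum_distrib_left sum_distrib_right by (subst sum.swap) (simp add: mult_ac)
  have 3: "(\<Sum>s\<in>UNIV. E_curv L i s x y * dX Z s j x y)
      = 1/2 * (\<Sum>r\<in>UNIV. \<Sum>s\<in>UNIV. berwald_curv L r i r s x y * dX Z s j x y)"
    unfolding E_curv_def sum_distrib_left sum_distrib_right by (subst sum.swap) (simp add: mult_ac)
  show ?thesis unfolding lie_cov2_def 1 2 3 by simp
qed

text \<open>Here \<open>H\<^sub>i\<^sub>j = S E\<^sub>i\<^sub>j - N\<^sup>r\<^sub>i E\<^sub>r\<^sub>j - N\<^sup>r\<^sub>j E\<^sub>i\<^sub>r\<close>. As \<open>\<pounds>E = 0\<close>, its Lie derivative comes from \<open>S\<close> and \<open>N\<close>. The bracket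
  of \<open>X^\<close> and \<open>S\<close> contributes \<open>-2 \<psi> C E\<^sub>i\<^sub>j = 2 \<psi> E\<^sub>i\<^sub>j\<close>, and \<open>\<pounds>N\<^sup>r\<^sub>i = \<psi> \<delta>\<^sup>r\<^sub>i + y\<^sup>r \<partial>\<psi>/\<partial>y\<^sup>i\<close> contributes
  \<open>- \<psi> E\<^sub>i\<^sub>j\<close> for each of the two indices because \<open>y\<^sup>r E\<^sub>r\<^sub>j = y\<^sup>r E\<^sub>i\<^sub>r = 0\<close>; the sum is zero.\<close>

lemma lie_H:
  assumes W: "(x, y) \<in> W"
  shows "lie_cov2 Z (H_curv L) i j x y = 0"
proof -
  let ?E = "E_curv L" and ?N = "nonlin_conn L" and ?A = "dX Z"
  note sm = smooth_intros smooth_dX smooth_nonlin_conn smooth_E_curv lf.smooth sp.smooth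
  have lieE: "complete_lift Z (?E i j) x y
      = - (\<Sum>r\<in>UNIV. ?E r j x y * ?A r i x y) - (\<Sum>r\<in>UNIV. ?E i r x y * ?A r j x y)"
    if "(x, y) \<in> W" for x y i j
    using lie_E[OF that, of i j] by (simp add: lie_cov2_def)
  have SA: "spray_field (?A r i) x y = (\<Sum>k\<in>UNIV. y $ k * pdx k (?A r i) x y)" for r i
    by (simp add: spray_field_eq pdy_dX)
  have SlieE: "spray_field (complete_lift Z (?E i j)) x y
      = - (\<Sum>r\<in>UNIV. spray_field (?E r j) x y * ?A r i x y) - (\<Sum>r\<in>UNIV. ?E r j x y * spray_field (?A r i) x y)
        - (\<Sum>r\<in>UNIV. spray_field (?E i r) x y * ?A r j x y) - (\<Sum>r\<in>UNIV. ?E i r x y * spray_field (?A r j) x y)"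
  proof -
    have "spray_field (complete_lift Z (?E i j)) x y = spray_field (\<lambda>x y.
        - (\<Sum>r\<in>UNIV. ?E r j x y * ?A r i x y) - (\<Sum>r\<in>UNIV. ?E i r x y * ?A r j x y)) x y"
      by (rule sp.cong[OF lieE W])
    also have "\<dots> = spray_field (\<lambda>x y. - (\<Sum>r\<in>UNIV. ?E r j x y * ?A r i x y)) x y
        - spray_field (\<lambda>x y. \<Sum>r\<in>UNIV. ?E i r x y * ?A r j x y) x y"
      by (intro sp.diff sm W)
    also have "spray_field (\<lambda>x y. - (\<Sum>r\<in>UNIV. ?E r j x y * ?A r i x y)) x y
        = - spray_field (\<lambda>x y. \<Sum>r\<in>UNIV. ?E r j x y * ?A r i x y) x y"
      by (intro sp.minus sm W)
    finally show ?thesis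
      by (simp only: sp.sum_mult[OF smooth_E_curv smooth_dX W])
  qed
  have H: "H_curv L i j x y = spray_field (?E i j) x y
      - (\<Sum>r\<in>UNIV. ?N r i x y * ?E r j x y) - (\<Sum>r\<in>UNIV. ?N r j x y * ?E i r x y)"
    if "(x, y) \<in> W" for x y i j
    unfolding H_curv_def by (rule nabla0_cov2_eq[OF that])
  have lieSE: "complete_lift Z (spray_field (?E i j)) x y
      = spray_field (complete_lift Z (?E i j)) x y + 2 * \<psi> x y * ?E i j x y"
    by (simp add: complete_lift_spray_field[OF smooth_E_curv W] euler_E_curv[OF W])
  have lieH: "complete_lift Z (H_curv L i j) x y = complete_lift Z (spray_field (?E i j)) x y
      - (\<Sum>r\<in>UNIV. complete_lift Z (?N r i) x y * ?E r j x y) - (\<Sum>r\<in>UNIV. ?N r i x y * complete_lift Z (?E r j) x y)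
      - (\<Sum>r\<in>UNIV. complete_lift Z (?N r j) x y * ?E i r x y) - (\<Sum>r\<in>UNIV. ?N r j x y * complete_lift Z (?E i r) x y)"
  proof -
    have "complete_lift Z (H_curv L i j) x y = complete_lift Z (\<lambda>x y. spray_field (?E i j) x y
      - (\<Sum>r\<in>UNIV. ?N r i x y * ?E r j x y) - (\<Sum>r\<in>UNIV. ?N r j x y * ?E i r x y)) x y"
      by (rule lf.cong[OF H W])
    also have "\<dots> = complete_lift Z (\<lambda>x y. spray_field (?E i j) x y - (\<Sum>r\<in>UNIV. ?N r i x y * ?E r j x y)) x y
      - complete_lift Z (\<lambda>x y. \<Sum>r\<in>UNIV. ?N r j x y * ?E i r x y) x y"
      by (intro lf.diff sm W)
    also have "complete_lift Z (\<lambda>x y. spray_field (?E i j) x y - (\<Sum>r\<in>UNIV. ?N r i x y * ?E r j x y)) x y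
      = complete_lift Z (spray_field (?E i j)) x y - complete_lift Z (\<lambda>x y. \<Sum>r\<in>UNIV. ?N r i x y * ?E r j x y) x y"
      by (intro lf.diff sm W)
    finally show ?thesis
      by (simp only: lf.sum_mult[OF smooth_nonlin_conn smooth_E_curv W])
  qed
  \<comment> \<open>The contribution of \<open>X^ (N\<^sup>r\<^sub>i)\<close> to one index, where \<open>t\<close> is a row or a column of \<open>E\<close>.\<close>
  have slot: "(\<Sum>r\<in>UNIV. complete_lift Z (?N r i) x y * t r) = \<psi> x y * t i
      + (\<Sum>r\<in>UNIV. \<Sum>m\<in>UNIV. ?N m i x y * ?A r m x y * t r)
      - (\<Sum>r\<in>UNIV. \<Sum>m\<in>UNIV. ?N r m x y * ?A m i x y * t r)
      - (\<Sum>r\<in>UNIV. t r * spray_field (?A r i) x y)"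
    if t: "(\<Sum>r\<in>UNIV. y $ r * t r) = 0" for t i
  proof -
    have "(\<Sum>r\<in>UNIV. complete_lift Z (?N r i) x y * t r)
        = (\<Sum>r\<in>UNIV. pdy i \<psi> x y * (y $ r * t r)) + (\<Sum>r\<in>UNIV. \<psi> x y * ((if r = i then 1 else 0) * t r))
          + (\<Sum>r\<in>UNIV. \<Sum>m\<in>UNIV. ?N m i x y * ?A r m x y * t r)
          - (\<Sum>r\<in>UNIV. \<Sum>m\<in>UNIV. ?N r m x y * ?A m i x y * t r)
          - (\<Sum>r\<in>UNIV. t r * spray_field (?A r i) x y)"
      unfolding lie_nonlin_conn[OF W] SA[symmetric] sum.distrib[symmetric] sum_subtractf[symmetric]
        sum_distrib_right[symmetric]
      by (intro sum.cong refl) (simp add: algebra_simps)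
    then show ?thesis
      by (simp only: sum_distrib_left[symmetric] t sum_UNIV_delta)
  qed
  have swap: "(\<Sum>r\<in>UNIV. \<Sum>m\<in>UNIV. f r m) = (\<Sum>r\<in>UNIV. \<Sum>m\<in>UNIV. f m r)" for f :: "'n \<Rightarrow> 'n \<Rightarrow> real"
    by (rule sum.swap)
  have lieE1: "(\<Sum>r\<in>UNIV. ?N r i x y * complete_lift Z (?E r j) x y)
      = - (\<Sum>r\<in>UNIV. \<Sum>m\<in>UNIV. ?N m i x y * ?A r m x y * ?E r j x y)
        - (\<Sum>r\<in>UNIV. \<Sum>m\<in>UNIV. ?N r i x y * ?E r m x y * ?A m j x y)"
    by (subst swap)
      (simp add: lieE[OF W] right_diff_distrib sum_subtractf sum_negf sum_distrib_left mult_ac)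
  have lieE2: "(\<Sum>r\<in>UNIV. ?N r j x y * complete_lift Z (?E i r) x y)
      = - (\<Sum>r\<in>UNIV. \<Sum>m\<in>UNIV. ?N r j x y * ?E m r x y * ?A m i x y)
        - (\<Sum>r\<in>UNIV. \<Sum>m\<in>UNIV. ?N m j x y * ?A r m x y * ?E i r x y)"
    by (subst swap[of "\<lambda>r m. ?N m j x y * ?A r m x y * ?E i r x y"])
      (simp add: lieE[OF W] right_diff_distrib sum_subtractf sum_negf sum_distrib_left mult_ac)
  have H1: "(\<Sum>r\<in>UNIV. H_curv L r j x y * ?A r i x y) = (\<Sum>r\<in>UNIV. spray_field (?E r j) x y * ?A r i x y)
      - (\<Sum>r\<in>UNIV. \<Sum>m\<in>UNIV. ?N r m x y * ?A m i x y * ?E r j x y)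
      - (\<Sum>r\<in>UNIV. \<Sum>m\<in>UNIV. ?N r j x y * ?E m r x y * ?A m i x y)"
    by (subst swap[of "\<lambda>r m. ?N r m x y * ?A m i x y * ?E r j x y"],
        subst swap[of "\<lambda>r m. ?N r j x y * ?E m r x y * ?A m i x y"])
      (simp add: H[OF W] right_diff_distrib left_diff_distrib sum_subtractf sum_distrib_left sum_distrib_right mult_ac)
  have H2: "(\<Sum>r\<in>UNIV. H_curv L i r x y * ?A r j x y) = (\<Sum>r\<in>UNIV. spray_field (?E i r) x y * ?A r j x y)
      - (\<Sum>r\<in>UNIV. \<Sum>m\<in>UNIV. ?N r i x y * ?E r m x y * ?A m j x y)
      - (\<Sum>r\<in>UNIV. \<Sum>m\<in>UNIV. ?N r m x y * ?A m j x y * ?E i r x y)"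
    by (subst swap[of "\<lambda>r m. ?N r i x y * ?E r m x y * ?A m j x y"],
        subst swap[of "\<lambda>r m. ?N r m x y * ?A m j x y * ?E i r x y"])
      (simp add: H[OF W] right_diff_distrib left_diff_distrib sum_subtractf sum_distrib_left sum_distrib_right mult_ac)
  show ?thesis
    unfolding lie_cov2_def lieH lieSE SlieE H1 H2 lieE1 lieE2
      slot[OF E_curv_contract(1)[OF W]] slot[OF E_curv_contract(2)[OF W]]
    by simp
qed

end

section \<open>Charts\<close>

lemma chart_inv_in:
  "x \<in> chart_image c \<Longrightarrow> chart_inv c x \<in> fst c" "x \<in> chart_image c \<Longrightarrow> snd c (chart_inv c x) = x"
  by (simp_all add: chart_image_def chart_inv_def inv_into_into f_inv_into_f)

context
  fixes M :: "'m topology" and \<A> :: "('m, 'n::finite) chart set"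
  assumes manifold: "smooth_manifold M \<A>"
begin

lemma
  assumes "c \<in> \<A>"
  shows open_chart_image: "open (chart_image c)"
    and chart_domain_subset: "fst c \<subseteq> topspace M"
    and homeomorphic_chart: "homeomorphic_map (subtopology M (fst c)) (top_of_set (chart_image c)) (snd c)"
    and open_chart_domain: "openin M (fst c)"
  using manifold assms by (auto simp: smooth_manifold_def openin_subset)

lemma chart_inv_chart:
  assumes "c \<in> \<A>" "q \<in> fst c" shows "chart_inv c (snd c q) = q"
proof -
  have "inj_on (snd c) (fst c)"
    using homeomorphic_imp_injective_map[OF homeomorphic_chart[OF assms(1)]] chart_domain_subset[OF assms(1)]
    by (simp add: Int_absorb1)
  then show ?thesis using assms(2) by (simp add: chart_inv_def)
qed

lemma open_overlap:
  assumes "c \<in> \<A>" "d \<in> \<A>" shows "open (snd c ` (fst c \<inter> fst d))"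
proof -
  have "openin (subtopology M (fst c)) (fst c \<inter> fst d)"
    unfolding openin_subtopology
    using open_chart_domain[OF assms(2)] by (intro exI[of _ "fst d"]) auto
  then have "openin (top_of_set (chart_image c)) (snd c ` (fst c \<inter> fst d))"
    unfolding homeomorphic_map_openness_eq[OF homeomorphic_chart[OF assms(1)]] by simp
  then show ?thesis using open_chart_image[OF assms(1)] openin_open_eq by blast
qed

lemma transition_differentiable:
  assumes "c \<in> \<A>" "d \<in> \<A>" "p \<in> fst c" "p \<in> fst d"
  shows "transition c d differentiable (at (snd c p))"
  using manifold assms by (auto simp: smooth_manifold_def intro!: smooth_on_differentiable)

lemma transition_self:
  assumes "c \<in> \<A>" "x \<in> chart_image c"
  shows "frechet_derivative (transition c c) (at x) = id"
proof -
  have "(transition c c has_derivative id) (at x)"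
  proof (rule has_derivative_transform_within_open)
    show "(id has_derivative id) (at x)" by (rule has_derivative_id)
    show "id x' = transition c c x'" if "x' \<in> chart_image c" for x'
      using that by (simp add: transition_def chart_inv_in)
  qed (use assms open_chart_image in auto)
  then show ?thesis using frechet_derivative_at by metis
qed

text \<open>The chain rule for transition maps makes the family of components that defines \<open>tangent_of_coords\<close>
  a tangent vector. Only with this membership do the homogeneity conditions, which are imposed on the
  bundles, say anything about coordinate expressions.\<close>

lemma transition_cocycle:
  assumes c: "c \<in> \<A>" "p \<in> fst c" and d: "d \<in> \<A>" "p \<in> fst d" and e: "e \<in> \<A>" "p \<in> fst e"
  shows "frechet_derivative (transition c e) (at (snd c p)) v
    = frechet_derivative (transition d e) (at (snd d p)) (frechet_derivative (transition c d) (at (snd c p)) v)"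
proof -
  have cd: "transition c d (snd c q) = snd d q" if "q \<in> fst c" for q
    using that c(1) by (simp add: transition_def chart_inv_chart)
  have "(transition c d has_derivative frechet_derivative (transition c d) (at (snd c p))) (at (snd c p))"
    using transition_differentiable[OF c(1) d(1) c(2) d(2)] by (simp add: frechet_derivative_works)
  moreover have "(transition d e has_derivative frechet_derivative (transition d e) (at (snd d p)))
      (at (transition c d (snd c p)))"
    using transition_differentiable[OF d(1) e(1) d(2) e(2)] by (simp add: frechet_derivative_works cd c(2))
  ultimately have "((\<lambda>x. transition d e (transition c d x)) has_derivative
      (\<lambda>v. frechet_derivative (transition d e) (at (snd d p)) (frechet_derivative (transition c d) (at (snd c p)) v)))
      (at (snd c p))"
    by (rule has_derivative_compose)
  then have "(transition c e has_derivative
      (\<lambda>v. frechet_derivative (transition d e) (at (snd d p)) (frechet_derivative (transition c d) (at (snd c p)) v)))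
      (at (snd c p))"
  proof (rule has_derivative_transform_within_open[OF _ open_overlap[OF c(1) d(1)]])
    show "snd c p \<in> snd c ` (fst c \<inter> fst d)" using c d by blast
    fix x assume "x \<in> snd c ` (fst c \<inter> fst d)"
    then obtain q where q: "q \<in> fst c" "q \<in> fst d" "x = snd c q" by blast
    then show "transition d e (transition c d x) = transition c e x"
      using c(1) d(1) by (simp add: cd) (simp add: transition_def chart_inv_chart)
  qed
  then show ?thesis using frechet_derivative_at by metis
qed

lemma tangent_of_coords_in_bundle:
  assumes c: "c \<in> \<A>" and x: "x \<in> chart_image c"
  shows "tangent_of_coords \<A> c x y \<in> tangent_bundle M \<A>"
proof -
  let ?p = "chart_inv c x"
  note p = chart_inv_in[OF x]
  have "?p \<in> topspace M" using p c chart_domain_subset by blast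
  moreover have "(\<lambda>d. if d \<in> \<A> \<and> ?p \<in> fst d then frechet_derivative (transition c d) (at x) y else 0)
      \<in> tangent_space \<A> ?p"
    unfolding tangent_space_def
  proof (intro CollectI conjI ballI allI impI)
    fix d e assume "d \<in> \<A>" "e \<in> \<A>" "?p \<in> fst d \<and> ?p \<in> fst e"
    then show "(if e \<in> \<A> \<and> ?p \<in> fst e then frechet_derivative (transition c e) (at x) y else 0)
        = frechet_derivative (transition d e) (at (snd d ?p))
            (if d \<in> \<A> \<and> ?p \<in> fst d then frechet_derivative (transition c d) (at x) y else 0)"
      using transition_cocycle[OF c p(1), of d e y] by (simp add: p(2))
  qed auto
  ultimately show ?thesis by (simp add: tangent_of_coords_def tangent_bundle_def)
qed

lemma tangent_of_coords_in_slit_bundle: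
  assumes c: "c \<in> \<A>" and x: "x \<in> chart_image c" and y: "y \<noteq> 0"
  shows "tangent_of_coords \<A> c x y \<in> slit_tangent_bundle M \<A>"
proof -
  have "snd (tangent_of_coords \<A> c x y) c = y"
    using c x chart_inv_in[OF x] by (simp add: tangent_of_coords_def transition_self)
  then have "snd (tangent_of_coords \<A> c x y) \<noteq> (\<lambda>c. 0)" using y by auto
  then show ?thesis
    using tangent_of_coords_in_bundle[OF c x, of y] by (auto simp: slit_tangent_bundle_def)
qed

text \<open>Fibrewise scaling in the bundle is scaling of \<open>y\<close> in coordinates, since the differentials of the
  transition maps are linear.\<close>

lemma tangent_of_coords_scale:
  assumes c: "c \<in> \<A>" and x: "x \<in> chart_image c"
  shows "tangent_of_coords \<A> c x (a *\<^sub>R y)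
    = (fst (tangent_of_coords \<A> c x y), \<lambda>d. a *\<^sub>R snd (tangent_of_coords \<A> c x y) d)"
proof -
  note p = chart_inv_in[OF x]
  have "frechet_derivative (transition c d) (at x) (a *\<^sub>R y) = a *\<^sub>R frechet_derivative (transition c d) (at x) y"
    if "d \<in> \<A>" "chart_inv c x \<in> fst d" for d
    using transition_differentiable[OF c that(1) p(1) that(2)]
    by (intro linear_scale linear_frechet_derivative) (simp add: p(2))
  then show ?thesis by (auto simp: tangent_of_coords_def fun_eq_iff)
qed

lemma local_expr_homogeneous:
  assumes "pos_homogeneous1_on S f" "c \<in> \<A>" "x \<in> chart_image c" "tangent_of_coords \<A> c x y \<in> S" "a > 0"
  shows "local_expr \<A> c f x (a *\<^sub>R y) = a * local_expr \<A> c f x y"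
  using assms(1,4,5) unfolding local_expr_def tangent_of_coords_scale[OF assms(2,3)] pos_homogeneous1_on_def
  by (cases "tangent_of_coords \<A> c x y") auto

end

lemma finsler_chart_local_expr:
  assumes "finsler_manifold M \<A> F" "c \<in> \<A>"
  shows "finsler_chart (chart_image c) (local_expr \<A> c F)"
proof
  have m: "smooth_manifold M \<A>" using assms(1) by (simp add: finsler_manifold_def)
  show "open (chart_image c)" by (rule open_chart_image[OF m assms(2)])
  show "smooth_cfun (chart_image c \<times> (UNIV - {0})) (local_expr \<A> c F)"
    using assms by (simp add: smooth_cfun_def finsler_manifold_def)
  show "local_expr \<A> c F x (a *\<^sub>R y) = a * local_expr \<A> c F x y"
    if "x \<in> chart_image c" "y \<noteq> 0" "a > 0" for x y a
    using assms that
    by (intro local_expr_homogeneous[OF m, of "tangent_bundle M \<A>"] tangent_of_coords_in_bundle[OF m])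
      (auto simp: finsler_manifold_def)
  show "v \<bullet> (gmat (local_expr \<A> c F) x y *v v) > 0"
    if "x \<in> chart_image c" "y \<noteq> 0" "v \<noteq> 0" for x y v
    using assms that by (auto simp: finsler_manifold_def)
qed

theorem proposition1:
  fixes M :: "'m topology"
    and \<A> :: "('m, 'n::finite) chart set"
    and F :: "'m \<times> ('m, 'n) tvec \<Rightarrow> real"
    and X :: "'m \<Rightarrow> ('m, 'n) tvec"
  assumes "finsler_manifold M \<A> F"
    and "I_projective_vf M \<A> F X"
  shows "lie_E_zero \<A> F X \<and> lie_H_zero \<A> F X \<and> lie_B_zero \<A> F X"
proof -
  have m: "smooth_manifold M \<A>" using assms(1) by (simp add: finsler_manifold_def)
  obtain \<Psi> where \<Psi>: "pos_homogeneous1_on (slit_tangent_bundle M \<A>) \<Psi>"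
    "\<And>c x y i. c \<in> \<A> \<Longrightarrow> x \<in> chart_image c \<Longrightarrow> y \<noteq> 0 \<Longrightarrow>
       lie_spray (local_vf c X) (spray (local_expr \<A> c F)) i x y = local_expr \<A> c \<Psi> x y * y $ i"
    using assms(2) unfolding I_projective_vf_def projective_vf_def by blast
  have X: "smooth_on (local_vf c X) (chart_image c)" if "c \<in> \<A>" for c
    using assms(2) that
    by (simp add: I_projective_vf_def projective_vf_def smooth_vector_field_def local_vf_def)
  have I: "lie_cov1 (local_vf c X) (mean_cartan (local_expr \<A> c F)) i x y = 0"
    if "c \<in> \<A>" "x \<in> chart_image c" "y \<noteq> 0" for c x y i
    using assms(2) that by (simp add: I_projective_vf_def lie_I_zero_def)
  have chart: "I_projective_chart (chart_image c) (local_expr \<A> c F) (local_vf c X) (local_expr \<A> c \<Psi>)"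
    if c: "c \<in> \<A>" for c
  proof -
    interpret finsler_chart "chart_image c" "local_expr \<A> c F"
      by (rule finsler_chart_local_expr[OF assms(1) c])
    show ?thesis
    proof
      show "smooth_on (local_vf c X) (chart_image c)" by (rule X[OF c])
      fix x and y :: "real^'n" assume "(x, y) \<in> W"
      then have xy: "x \<in> chart_image c" "y \<noteq> 0" by (auto simp: W_def)
      show "lie_spray (local_vf c X) (spray (local_expr \<A> c F)) i x y = local_expr \<A> c \<Psi> x y * y $ i" for i
        by (rule \<Psi>(2)[OF c xy])
      show "lie_cov1 (local_vf c X) (mean_cartan (local_expr \<A> c F)) i x y = 0" for i
        by (rule I[OF c xy])
      show "local_expr \<A> c \<Psi> x (a *\<^sub>R y) = a * local_expr \<A> c \<Psi> x y" if "a > 0" for a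
        by (rule local_expr_homogeneous[OF m \<Psi>(1) c xy(1) tangent_of_coords_in_slit_bundle[OF m c xy] that])
    qed
  qed
  have W: "finsler_chart.W (chart_image c) = chart_image c \<times> (UNIV - {0 :: real^'n})" if "c \<in> \<A>" for c
    by (rule finsler_chart.W_def[OF finsler_chart_local_expr[OF assms(1) that]])
  show ?thesis
    unfolding lie_E_zero_def lie_H_zero_def lie_B_zero_def
    by (intro conjI ballI allI impI I_projective_chart.lie_E[OF chart] I_projective_chart.lie_H[OF chart]
        I_projective_chart.lie_B[OF chart]) (simp_all add: W)
qed

end
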